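(* Let $n>m\geq 2$ and $t\geq 1$ be integers, let $K$ be a field, $S=K[x_1,\ldots,x_n]$, and let $J_{n,m}\subset S$ be the $m$-path ideal of the cycle graph on $n$ vertices. If $n\geq 2m+1$, then $$\operatorname{depth}(S/J_{n,m}^t) \leq \begin{cases} \varphi(n,m,t),& t\leq n-2m, \\ \varphi(n-1,m,t)+1,& n-2m+1\leq t\leq n-m, \\ m,& t\geq n-m+1. \end{cases}$$
   Context: $J_{n,m}=(x_ix_{i+1}\cdots x_{i+m-1} : 1\le i\le n)\subset S$, where indices are read modulo $n$ in $\{1,\ldots,n\}$. For integers $1\le m\le n$ and $t\ge 1$, $$\varphi(n,m,t):= \begin{cases} n -t+2 - \left\lfloor \frac{n-t+2}{m+1} \right\rfloor - \left\lceil \frac{n-t+2}{m+1} \right\rceil, & t \leq n+1-m, \\ m-1,& t > n+1-m. \end{cases}$$ $\operatorname{depth}$ is the depth of a finitely generated graded $S$-module with respect to the maximal ideal $(x_1,\ldots,x_n)$. *)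

theory Defs
  imports
    "HOL-Library.Poly_Mapping"
    "HOL-Library.Extended_Real"
    "HOL-Algebra.QuotRing"
    "HOL-Algebra.Ideal_Product"
    "HOL-Algebra.Module"
begin

section \<open>Modules over a commutative ring\<close>

definition self_module :: "('a, 'm) ring_scheme \<Rightarrow> ('a, 'a) module" where
  "self_module R =
     \<lparr>carrier = carrier R, mult = mult R, one = one R, zero = zero R, add = add R,
      smult = mult R\<rparr>"

text \<open>
  The module record type extends the ring record type, so it carries the fields \<^term>\<open>mult\<close> and
  \<^term>\<open>one\<close>; they play no role in the locale \<^locale>\<open>module\<close> and are left unspecified here.
\<close>

definition quot_module :: "('a, 'b, 'm) module_scheme \<Rightarrow> 'b set \<Rightarrow> ('a, 'b set) module" where
  "quot_module M N =
     \<lparr>carrier = a_rcosets\<^bsub>M\<^esub> N, mult = undefined, one = undefined, zero = N, add = set_add M,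
      smult = (\<lambda>a X. \<Union>x\<in>X. N +>\<^bsub>M\<^esub> (a \<odot>\<^bsub>M\<^esub> x))\<rparr>"

definition ideal_smult ::
  "('a, 'r) ring_scheme \<Rightarrow> 'a set \<Rightarrow> ('a, 'b, 'm) module_scheme \<Rightarrow> 'b set" where
  "ideal_smult R I M =
     \<Inter>{N. submodule N R M \<and> (\<forall>a\<in>I. \<forall>x\<in>carrier M. a \<odot>\<^bsub>M\<^esub> x \<in> N)}"

definition regular_element ::
  "('a, 'r) ring_scheme \<Rightarrow> ('a, 'b, 'm) module_scheme \<Rightarrow> 'a \<Rightarrow> bool" where
  "regular_element R M a \<longleftrightarrow>
     a \<in> carrier R \<and> (\<forall>x\<in>carrier M. a \<odot>\<^bsub>M\<^esub> x = \<zero>\<^bsub>M\<^esub> \<longrightarrow> x = \<zero>\<^bsub>M\<^esub>)"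

definition regular_sequence ::
  "('a, 'r) ring_scheme \<Rightarrow> ('a, 'b, 'm) module_scheme \<Rightarrow> 'a list \<Rightarrow> bool" where
  "regular_sequence R M xs \<longleftrightarrow>
     (\<forall>i<length xs.
        regular_element R
          (quot_module M (ideal_smult R (genideal R (set (take i xs))) M)) (xs ! i)) \<and>
     ideal_smult R (genideal R (set xs)) M \<noteq> carrier M"

text \<open>
  The depth (grade) of \<open>M\<close> with respect to the ideal \<open>I\<close>, with the usual convention that it is
  \<open>\<infinity>\<close> if \<open>I M = M\<close>.
\<close>

definition depth ::
  "('a, 'r) ring_scheme \<Rightarrow> 'a set \<Rightarrow> ('a, 'b, 'm) module_scheme \<Rightarrow> enat" where
  "depth R I M =
     (if ideal_smult R I M = carrier M then \<infinity>
      else (SUP xs \<in> {xs. set xs \<subseteq> I \<and> regular_sequence R M xs}. enat (length xs)))"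

lemma (in cring) module_self_module: "module R (self_module R)"
proof (rule moduleI)
  show "cring R" by (rule is_cring)
  show "abelian_group (self_module R)"
    by (rule abelian_groupI)
       (auto simp: self_module_def a_ac intro: l_neg)
qed (auto simp: self_module_def l_distr r_distr m_assoc)

lemma (in ideal) submodule_self_module: "submodule I R (self_module R)"
proof -
  have "subgroup I (add_monoid (self_module R))"
    using a_subgroup by (simp add: subgroup_def self_module_def m_inv_def)
  then show ?thesis
    by (auto simp: submodule_def submodule_axioms_def self_module_def I_l_closed)
qed

lemma (in module) module_quot_module:
  assumes "submodule N R M"
  shows "module R (quot_module M N)"
proof -
  interpret N: submodule N R M by fact
  have sub: "additive_subgroup N M"
    by (simp add: additive_subgroup_def N.subgroup_axioms)
  interpret A: abelian_subgroup N M
    by (rule abelian_subgroupI3) (use sub M.abelian_group_axioms in auto)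
  have car: "carrier (quot_module M N) = (\<lambda>x. N +>\<^bsub>M\<^esub> x) ` carrier M"
    by (auto simp: quot_module_def A_RCOSETS_def')
  have add: "(N +>\<^bsub>M\<^esub> x) \<oplus>\<^bsub>quot_module M N\<^esub> (N +>\<^bsub>M\<^esub> y) = N +>\<^bsub>M\<^esub> (x \<oplus>\<^bsub>M\<^esub> y)"
    if "x \<in> carrier M" "y \<in> carrier M" for x y
    using that by (simp add: quot_module_def A.a_rcos_sum)
  have zero: "\<zero>\<^bsub>quot_module M N\<^esub> = N +>\<^bsub>M\<^esub> \<zero>\<^bsub>M\<^esub>"
    by (simp add: quot_module_def A.a_subset)
  have smult: "a \<odot>\<^bsub>quot_module M N\<^esub> (N +>\<^bsub>M\<^esub> x) = N +>\<^bsub>M\<^esub> (a \<odot>\<^bsub>M\<^esub> x)"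
    if a: "a \<in> carrier R" and x: "x \<in> carrier M" for a x
  proof -
    have "N +>\<^bsub>M\<^esub> (a \<odot>\<^bsub>M\<^esub> y) = N +>\<^bsub>M\<^esub> (a \<odot>\<^bsub>M\<^esub> x)" if "y \<in> N +>\<^bsub>M\<^esub> x" for y
    proof -
      from that obtain h where h: "h \<in> N" "y = h \<oplus>\<^bsub>M\<^esub> x"
        by (auto simp: a_r_coset_def')
      then have "a \<odot>\<^bsub>M\<^esub> y = (a \<odot>\<^bsub>M\<^esub> h) \<oplus>\<^bsub>M\<^esub> (a \<odot>\<^bsub>M\<^esub> x)"
        using a x A.a_subset by (auto simp: smult_r_distr)
      then have "a \<odot>\<^bsub>M\<^esub> y \<in> N +>\<^bsub>M\<^esub> (a \<odot>\<^bsub>M\<^esub> x)"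
        using h a by (auto simp: a_r_coset_def')
      then show ?thesis
        using a x by (metis A.a_repr_independence' A.a_subgroup smult_closed)
    qed
    moreover have "N +>\<^bsub>M\<^esub> x \<noteq> {}"
      using x A.a_rcos_self by blast
    ultimately show ?thesis
      by (auto simp: quot_module_def)
  qed
  show ?thesis
  proof (rule moduleI)
    show "cring R" by (rule R.is_cring)
    show "abelian_group (quot_module M N)"
    proof (rule abelian_groupI)
      fix X assume "X \<in> carrier (quot_module M N)"
      then obtain x where x: "x \<in> carrier M" "X = N +>\<^bsub>M\<^esub> x" by (auto simp: car)
      then show "\<exists>Y\<in>carrier (quot_module M N). Y \<oplus>\<^bsub>quot_module M N\<^esub> X = \<zero>\<^bsub>quot_module M N\<^esub>"
        by (intro bexI[of _ "N +>\<^bsub>M\<^esub> (\<ominus>\<^bsub>M\<^esub> x)"]) (auto simp: car add zero M.l_neg)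
    qed (auto simp: car add zero M.a_ac)
  qed (auto simp: car add smult smult_l_distr smult_r_distr smult_assoc1)
qed

section \<open>Polynomial rings and path ideals of cycles\<close>

text \<open>
  A polynomial is a finitely supported map from exponent vectors to coefficients, with the
  convolution product of \<^theory>\<open>HOL-Library.Poly_Mapping\<close>. The ring \<open>poly_ring n\<close> consists of the
  polynomials in which only the variables with index in \<open>{1..n}\<close> occur.
\<close>

type_synonym 'k mpoly = "(nat \<Rightarrow>\<^sub>0 nat) \<Rightarrow>\<^sub>0 'k"

definition poly_ring :: "nat \<Rightarrow> 'k::field mpoly ring" where
  "poly_ring n =
     \<lparr>carrier = {p. \<forall>u\<in>Poly_Mapping.keys p. Poly_Mapping.keys u \<subseteq> {1..n}},
      mult = (*), one = 1, zero = 0, add = (+)\<rparr>"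

definition var :: "nat \<Rightarrow> 'k::field mpoly" where
  "var i = Poly_Mapping.single (Poly_Mapping.single i 1) 1"

definition max_ideal :: "nat \<Rightarrow> 'k::field mpoly set" where
  "max_ideal n = genideal (poly_ring n) (var ` {1..n})"

text \<open>The representative of \<open>k\<close> modulo \<open>n\<close> in \<open>{1..n}\<close>, for \<open>k \<ge> 1\<close>.\<close>

definition cyc_index :: "nat \<Rightarrow> nat \<Rightarrow> nat" where
  "cyc_index n k = (k - 1) mod n + 1"

definition cycle_path_ideal :: "nat \<Rightarrow> nat \<Rightarrow> 'k::field mpoly set" where
  "cycle_path_ideal n m =
     genideal (poly_ring n) ((\<lambda>i. \<Prod>j\<in>{i..<i + m}. var (cyc_index n j)) ` {1..n})"

definition phi :: "nat \<Rightarrow> nat \<Rightarrow> nat \<Rightarrow> int" where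
  "phi n m t =
     (if int t \<le> int n + 1 - int m
      then int n - int t + 2
           - \<lfloor>real_of_int (int n - int t + 2) / real (m + 1)\<rfloor>
           - \<lceil>real_of_int (int n - int t + 2) / real (m + 1)\<rceil>
      else int m - 1)"

lemma cring_poly_ring: "cring (poly_ring n :: 'k::field mpoly ring)"
proof (rule cringI)
  let ?S = "poly_ring n :: 'k mpoly ring"
  have add: "p + q \<in> carrier ?S" if "p \<in> carrier ?S" "q \<in> carrier ?S" for p q
    using that subsetD[OF Poly_Mapping.keys_add[of p q]] by (auto simp: poly_ring_def)
  have mult: "p * q \<in> carrier ?S" if pq: "p \<in> carrier ?S" "q \<in> carrier ?S" for p q
  proof -
    have "Poly_Mapping.keys u \<subseteq> {1..n}" if u: "u \<in> Poly_Mapping.keys (p * q)" for u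
    proof -
      from u keys_mult[of p q] obtain a b
        where "u = a + b" "a \<in> Poly_Mapping.keys p" "b \<in> Poly_Mapping.keys q"
        by blast
      then show ?thesis
        using pq Poly_Mapping.keys_add[of a b] unfolding poly_ring_def
        by (simp add: subset_iff) blast
    qed
    then show ?thesis by (simp add: poly_ring_def)
  qed
  have ops: "(\<oplus>\<^bsub>?S\<^esub>) = (+)" "(\<otimes>\<^bsub>?S\<^esub>) = (*)" "\<zero>\<^bsub>?S\<^esub> = 0" "\<one>\<^bsub>?S\<^esub> = 1"
    by (simp_all add: poly_ring_def)
  have consts_closed: "0 \<in> carrier ?S" "1 \<in> carrier ?S"
    by (simp_all add: poly_ring_def)
  show "abelian_group ?S"
  proof (rule abelian_groupI)
    fix p assume "p \<in> carrier ?S"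
    then have "- p \<in> carrier ?S" by (simp add: poly_ring_def)
    then show "\<exists>q\<in>carrier ?S. q \<oplus>\<^bsub>?S\<^esub> p = \<zero>\<^bsub>?S\<^esub>"
      by (intro bexI[of _ "- p"]) (simp_all add: ops)
  qed (simp_all add: ops add consts_closed ac_simps)
  show "comm_monoid ?S"
    by (rule comm_monoidI) (simp_all add: ops mult consts_closed ac_simps)
  show "(p \<oplus>\<^bsub>?S\<^esub> q) \<otimes>\<^bsub>?S\<^esub> r = p \<otimes>\<^bsub>?S\<^esub> r \<oplus>\<^bsub>?S\<^esub> q \<otimes>\<^bsub>?S\<^esub> r" for p q r
    by (simp add: ops distrib_right)
qed

lemma var_closed: "i \<in> {1..n} \<Longrightarrow> var i \<in> carrier (poly_ring n)"
  by (simp add: var_def poly_ring_def)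

lemma ideal_max_ideal: "ideal (max_ideal n) (poly_ring n)"
proof -
  interpret cring "poly_ring n :: 'a mpoly ring" by (rule cring_poly_ring)
  show "ideal (max_ideal n :: 'a mpoly set) (poly_ring n)"
    unfolding max_ideal_def by (rule genideal_ideal) (use var_closed in blast)
qed

lemma ideal_cycle_path_ideal:
  assumes "n \<ge> 1"
  shows "ideal (cycle_path_ideal n m) (poly_ring n)"
proof -
  interpret cring "poly_ring n :: 'a mpoly ring" by (rule cring_poly_ring)
  have idx: "cyc_index n j \<in> {1..n}" for j
    using assms mod_less_divisor[of n "j - 1"] unfolding cyc_index_def atLeastAtMost_iff
    by linarith
  have "(\<Prod>j\<in>A. var (cyc_index n j) :: 'a mpoly) \<in> carrier (poly_ring n)" for A :: "nat set"
  proof (induction A rule: infinite_finite_induct)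
    case (insert j A)
    then show ?case
      using m_closed[OF var_closed[OF idx[of j]], of "\<Prod>j\<in>A. var (cyc_index n j)"]
      by (simp add: poly_ring_def)
  qed (use one_closed in \<open>simp_all add: poly_ring_def\<close>)
  then show "ideal (cycle_path_ideal n m :: 'a mpoly set) (poly_ring n)"
    unfolding cycle_path_ideal_def by (intro genideal_ideal) blast
qed

end

theory Submission
  imports Defs
begin

text \<open>
  A nonzero class in degree \<open>i\<close> of the Koszul cohomology of \<open>M = S/J\<^sup>t\<close> with respect to powers of
  the variables forces \<open>depth M \<le> i\<close>: if \<open>a\<close> is the first element of a regular sequence, some
  multiple of the class by a power of \<open>a\<close> is nonzero and killed by \<open>a\<close>, so it comes from a nonzero
  class of \<open>M/aM\<close> in degree \<open>i - 1\<close>. Hence a single nonzero class suffices. Let \<open>u\<close> be a suitable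
  product of \<open>t - 1\<close> path monomials. On an initial interval of indices \<open>J\<^sup>t : u\<close> contains every
  product of one variable from each residue class modulo \<open>m\<close>. The remaining indices are split into
  blocks of length \<open>m + 1\<close>, and the complex of squarefree monomials outside \<open>J\<^sup>t : u\<close> contains a
  sphere, the join of one boundary of an \<open>(m - 1)\<close>-simplex for each block. The dual
  cocycle is a product of one-forms \<open>\<Sum>x\<^sub>j e\<^sub>j\<close>. Its product with the complementary one-forms
  (the sphere) has a nonzero coefficient in top degree, which no coboundary can have.
  Indices left over by the blocks raise the degree by one each, except that \<open>m\<close> of them cost only
  \<open>m - 1\<close>; this accounts for the floor and ceiling in \<open>phi\<close>.
\<close>

section \<open>Koszul cochains\<close>

text \<open>Nonvanishing is read off one coefficient, that of \<open>top_exp\<close> in top degree,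
  so no homology is computed and the argument is the same over every field. The polynomials without
  this coefficient form only an additive group, hence the separate \<open>N\<close> in
  \<open>koszul_nonvanishing\<close>. What makes the cycle behave like a path is that the last
  variable does not divide \<open>top_exp\<close>: a window that wraps around contains the index n,
  so it cannot divide a factor of this monomial. The power t enters through residue classes: t - 1
  windows give each class total exponent at most t - 1, the sphere adds one, and removing one vertex
  leaves too little for t windows, each of which needs one variable of the class. The initial
  interval grows with the number \<open>t0\<close>, but one block must still fit behind it. So
  \<open>t0 = t\<close> while t \<le> n - m, and \<open>t0 = n - m\<close> afterwards; the surplus
  windows only pad \<open>u\<close>. Squares of variables serve the case of m leftover indices. With
  the square of a variable in the sequence, its first power is allowed in the cocycle; multiplying
  by the last variable then completes one more window, and the index n costs no degree.\<close>

definition ksgn :: "nat \<Rightarrow> nat set \<Rightarrow> 'a::comm_ring_1" where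
  "ksgn j F = (- 1) ^ card {k \<in> F. k < j}"

definition wedge :: "(nat \<Rightarrow> 'a::comm_ring_1) \<Rightarrow> (nat set \<Rightarrow> 'a) \<Rightarrow> nat set \<Rightarrow> 'a" where
  "wedge \<eta> f F = (\<Sum>j\<in>F. ksgn j F * \<eta> j * f (F - {j}))"

lemma ksgn_sq [simp]: "ksgn j F * ksgn j F = (1 :: 'a::comm_ring_1)"
  by (simp add: ksgn_def flip: power_mult_distrib)

lemma ksgn_cases: "(ksgn j F :: 'a::comm_ring_1) = 1 \<or> (ksgn j F :: 'a) = - 1"
  by (simp add: ksgn_def) (metis minus_one_power_iff)

lemma ksgn_swap_less:
  assumes "finite F" "j \<in> F" "j < k"
  shows "ksgn k F * ksgn j (F - {k}) = - (ksgn j F * ksgn k (F - {j}) :: 'a::comm_ring_1)"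
proof -
  have 1: "{i \<in> F - {k}. i < j} = {i \<in> F. i < j}"
    using assms by auto
  have 2: "{i \<in> F. i < k} = insert j {i \<in> F - {j}. i < k}"
    using assms by auto
  have "card {i \<in> F. i < k} = Suc (card {i \<in> F - {j}. i < k})"
    unfolding 2 using assms by (subst card_insert_disjoint) auto
  then show ?thesis
    unfolding ksgn_def 1 by (simp add: mult_ac)
qed

lemma ksgn_swap:
  assumes "finite F" "j \<in> F" "k \<in> F" "j \<noteq> k"
  shows "ksgn k F * ksgn j (F - {k}) = - (ksgn j F * ksgn k (F - {j}) :: 'a::comm_ring_1)"
proof (cases "j < k")
  case True
  then show ?thesis using ksgn_swap_less assms by blast
next
  case False
  then have "k < j" using assms by simp
  then have "ksgn j F * ksgn k (F - {j}) = - (ksgn k F * ksgn j (F - {k}) :: 'a)"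
    using ksgn_swap_less assms by blast
  then show ?thesis by simp
qed

lemma wedge_infinite: "infinite F \<Longrightarrow> wedge \<eta> f F = 0"
  by (simp add: wedge_def)

text \<open>Pairing (j, k) with (k, j) turns the double sum into one over 2 x 2 minors of the two
  forms. Antisymmetry and the vanishing of squares are both read off from it; in characteristic 2
  the latter does not follow from the former.\<close>

lemma wedge_wedge_eq:
  fixes \<eta> \<theta> :: "nat \<Rightarrow> 'a::comm_ring_1"
  assumes "finite F"
  shows "wedge \<eta> (wedge \<theta> f) F =
    (\<Sum>(j, k) \<in> {(j, k). j \<in> F \<and> k \<in> F \<and> j < k}.
      (\<eta> j * \<theta> k - \<eta> k * \<theta> j) * (ksgn j F * ksgn k (F - {j}) * f (F - {j} - {k})))"
proof -
  define T where "T j k = ksgn j F * ksgn k (F - {j}) * f (F - {j} - {k})" for j k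
  define U where "U = {(j, k). j \<in> F \<and> k \<in> F \<and> j < k}"
  define L where "L = {(j, k). j \<in> F \<and> k \<in> F \<and> k < j}"
  have sub: "U \<subseteq> F \<times> F" "L \<subseteq> F \<times> F"
    by (auto simp: U_def L_def)
  have fin: "finite U" "finite L"
    using finite_subset[OF sub(1)] finite_subset[OF sub(2)] assms by simp_all
  have split: "Sigma F (\<lambda>j. F - {j}) = U \<union> L"
    by (auto simp: U_def L_def)
  have anti: "T k j = - T j k" if "(j, k) \<in> U" for j k
  proof -
    have "ksgn k F * ksgn j (F - {k}) = - (ksgn j F * ksgn k (F - {j}) :: 'a)"
      using that assms by (intro ksgn_swap) (auto simp: U_def)
    moreover have "F - {k} - {j} = F - {j} - {k}" by auto
    ultimately show ?thesis by (simp add: T_def)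
  qed
  have "wedge \<eta> (wedge \<theta> f) F = (\<Sum>j\<in>F. \<Sum>k\<in>F - {j}. \<eta> j * \<theta> k * T j k)"
    by (simp add: wedge_def T_def sum_distrib_left mult_ac)
  also have "\<dots> = (\<Sum>(j, k) \<in> Sigma F (\<lambda>j. F - {j}). \<eta> j * \<theta> k * T j k)"
    using assms by (intro sum.Sigma) auto
  also have "\<dots> = (\<Sum>(j, k) \<in> U. \<eta> j * \<theta> k * T j k) + (\<Sum>(j, k) \<in> L. \<eta> j * \<theta> k * T j k)"
    unfolding split using fin by (intro sum.union_disjoint) (auto simp: U_def L_def)
  also have "(\<Sum>(j, k) \<in> L. \<eta> j * \<theta> k * T j k) = (\<Sum>(j, k) \<in> U. \<eta> k * \<theta> j * T k j)"
    by (intro sum.reindex_bij_witness[of _ prod.swap prod.swap]) (auto simp: U_def L_def)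
  also have "\<dots> = (\<Sum>(j, k) \<in> U. - (\<eta> k * \<theta> j * T j k))"
    by (intro sum.cong) (auto simp: anti)
  also have "(\<Sum>(j, k) \<in> U. \<eta> j * \<theta> k * T j k) + \<dots> = (\<Sum>(j, k) \<in> U. (\<eta> j * \<theta> k - \<eta> k * \<theta> j) * T j k)"
    by (subst sum.distrib[symmetric]) (auto intro!: sum.cong simp: algebra_simps)
  finally show ?thesis by (simp add: U_def T_def)
qed

lemma wedge_anticommute: "wedge \<eta> (wedge \<theta> f) F = - wedge \<theta> (wedge \<eta> f) F"
proof (cases "finite F")
  case True
  then show ?thesis
    by (simp add: wedge_wedge_eq sum_negf[symmetric]) (intro sum.cong, auto simp: algebra_simps)
qed (simp add: wedge_infinite)

lemma wedge_wedge_self: "wedge \<eta> (wedge \<eta> f) F = 0"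
  by (cases "finite F") (simp_all add: wedge_wedge_eq wedge_infinite mult.commute)

lemma wedge_add_right: "wedge \<eta> (\<lambda>F. f F + g F) F = wedge \<eta> f F + wedge \<eta> g F"
  by (simp add: wedge_def algebra_simps sum.distrib)

lemma wedge_diff_right: "wedge \<eta> (\<lambda>F. f F - g F) F = wedge \<eta> f F - wedge \<eta> g F"
  by (simp add: wedge_def algebra_simps sum_subtractf)

lemma wedge_cmult_right: "wedge \<eta> (\<lambda>F. c * f F) F = c * wedge \<eta> f F"
  by (simp add: wedge_def sum_distrib_left mult_ac)

lemma wedge_zero_right: "wedge \<eta> (\<lambda>F. 0) F = 0"
  by (simp add: wedge_def)

lemma wedge_add_left: "wedge (\<lambda>j. \<eta> j + \<theta> j) f F = wedge \<eta> f F + wedge \<theta> f F"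
  by (simp add: wedge_def algebra_simps sum.distrib)

lemma wedge_cmult_left: "wedge (\<lambda>j. c * \<eta> j) f F = c * wedge \<eta> f F"
  by (simp add: wedge_def sum_distrib_left mult_ac)

lemma wedge_sum_left: "wedge (\<lambda>j. \<Sum>a\<in>A. \<eta> a j) f F = (\<Sum>a\<in>A. wedge (\<eta> a) f F)"
  by (induction A rule: infinite_finite_induct) (simp_all add: wedge_add_left, simp_all add: wedge_def)

text \<open>Contraction with the \<open>j\<close>-th basis vector is a homotopy between multiplication by \<open>y j\<close> and
  zero on the Koszul complex of \<open>y\<close>.\<close>

definition contract :: "nat \<Rightarrow> (nat set \<Rightarrow> 'a::comm_ring_1) \<Rightarrow> nat set \<Rightarrow> 'a" where
  "contract j f F = (if j \<in> F then 0 else ksgn j (insert j F) * f (insert j F))"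

lemma wedge_contract:
  assumes "finite F"
  shows "wedge y (contract j f) F + contract j (wedge y f) F = y j * f F"
proof (cases "j \<in> F")
  case True
  have "wedge y (contract j f) F = (\<Sum>k\<in>F. if k = j then y j * f F else 0)"
    unfolding wedge_def
  proof (intro sum.cong refl)
    fix k assume "k \<in> F"
    show "ksgn k F * y k * contract j f (F - {k}) = (if k = j then y j * f F else 0)"
    proof (cases "k = j")
      case True
      have "ksgn j F * y j * (ksgn j F * f F) = (ksgn j F * ksgn j F) * (y j * f F)"
        by (simp only: mult_ac)
      then show ?thesis using True \<open>j \<in> F\<close> by (simp add: contract_def insert_absorb)
    qed (use \<open>j \<in> F\<close> in \<open>simp add: contract_def\<close>)
  qed
  then show ?thesis using True assms by (simp add: contract_def)
next
  case False
  let ?G = "insert j F"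
  have "contract j (wedge y f) F =
      ksgn j ?G * (ksgn j ?G * y j * f F + (\<Sum>k\<in>F. ksgn k ?G * y k * f (?G - {k})))"
    using False assms by (simp add: contract_def wedge_def)
  also have "\<dots> = (ksgn j ?G * ksgn j ?G) * (y j * f F)
      + (\<Sum>k\<in>F. ksgn j ?G * ksgn k ?G * (y k * f (?G - {k})))"
    by (simp only: distrib_left sum_distrib_left mult_ac)
  also have "(\<Sum>k\<in>F. ksgn j ?G * ksgn k ?G * (y k * f (?G - {k}))) = - wedge y (contract j f) F"
    unfolding wedge_def sum_negf[symmetric]
  proof (intro sum.cong refl)
    fix k assume k: "k \<in> F"
    then have ne: "k \<noteq> j" using False by auto
    have sets: "insert j (F - {k}) = ?G - {k}" "F = ?G - {j}" using False ne by auto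
    \<comment> \<open>Removing j and k in the other order changes the sign, so the mixed terms of
      the two halves of the homotopy cancel.\<close>
    have sw: "ksgn k ?G * ksgn j (?G - {k}) = - (ksgn j ?G * ksgn k (?G - {j}) :: 'a)"
      using assms k ne by (intro ksgn_swap) auto
    have "ksgn j ?G * ksgn k ?G = ksgn j ?G * ksgn k ?G * (ksgn j (?G - {k}) * ksgn j (?G - {k}) :: 'a)"
      by simp
    also have "\<dots> = ksgn j ?G * (ksgn k ?G * ksgn j (?G - {k})) * ksgn j (?G - {k})"
      by (simp only: mult_ac)
    also have "\<dots> = - (ksgn j ?G * ksgn j ?G) * (ksgn k F * ksgn j (?G - {k}))"
      by (simp only: sw sets(2)[symmetric]) (simp only: mult_ac mult_minus_left mult_minus_right)
    finally have "ksgn j ?G * ksgn k ?G = - (ksgn k F * ksgn j (?G - {k}) :: 'a)"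
      by simp
    moreover have "contract j f (F - {k}) = ksgn j (?G - {k}) * f (?G - {k})"
      using False by (simp add: contract_def sets(1))
    ultimately show "ksgn j ?G * ksgn k ?G * (y k * f (?G - {k})) = - (ksgn k F * y k * contract j f (F - {k}))"
      by (simp add: mult_ac)
  qed
  finally show ?thesis by simp
qed

section \<open>Ideals of a subring, regular sequences and Koszul classes\<close>

locale coefficient_ring =
  fixes C :: "'a::comm_ring_1 set"
  assumes zero_in [simp]: "0 \<in> C" and one_in [simp]: "1 \<in> C"
    and add_in [simp]: "a \<in> C \<Longrightarrow> b \<in> C \<Longrightarrow> a + b \<in> C"
    and minus_in [simp]: "a \<in> C \<Longrightarrow> - a \<in> C"
    and mult_in [simp]: "a \<in> C \<Longrightarrow> b \<in> C \<Longrightarrow> a * b \<in> C"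
begin

lemma diff_in [simp]: "a \<in> C \<Longrightarrow> b \<in> C \<Longrightarrow> a - b \<in> C"
  using add_in[of a "- b"] by simp

lemma power_in [simp]: "a \<in> C \<Longrightarrow> a ^ k \<in> C"
  by (induction k) auto

lemma sum_in: "(\<And>j. j \<in> A \<Longrightarrow> f j \<in> C) \<Longrightarrow> sum f A \<in> C"
  by (induction A rule: infinite_finite_induct) auto

lemma ksgn_in [simp]: "ksgn j F \<in> C"
  using ksgn_cases[of j F] minus_in[OF one_in] one_in by metis

lemma wedge_in: "(\<And>j. j \<in> F \<Longrightarrow> \<eta> j \<in> C) \<Longrightarrow> (\<And>F. f F \<in> C) \<Longrightarrow> wedge \<eta> f F \<in> C"
  unfolding wedge_def by (intro sum_in) auto

text \<open>Ideals of the subring \<open>C\<close>, not of the whole type: the polynomial type has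
  infinitely many variables, and working inside \<open>C\<close> keeps its ordinary
  arithmetic.\<close>

definition ideal_of :: "'a set \<Rightarrow> bool" where
  "ideal_of K \<longleftrightarrow> K \<subseteq> C \<and> 0 \<in> K \<and> (\<forall>a\<in>K. \<forall>b\<in>K. a + b \<in> K) \<and> (\<forall>c\<in>C. \<forall>a\<in>K. c * a \<in> K)"

lemma ideal_ofI:
  assumes "K \<subseteq> C" "0 \<in> K" "\<And>a b. a \<in> K \<Longrightarrow> b \<in> K \<Longrightarrow> a + b \<in> K"
    "\<And>c a. c \<in> C \<Longrightarrow> a \<in> K \<Longrightarrow> c * a \<in> K"
  shows "ideal_of K"
  using assms by (auto simp: ideal_of_def)

lemma ideal_ofD:
  assumes "ideal_of K"
  shows "a \<in> K \<Longrightarrow> a \<in> C" "0 \<in> K" "a \<in> K \<Longrightarrow> b \<in> K \<Longrightarrow> a + b \<in> K"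
    "c \<in> C \<Longrightarrow> a \<in> K \<Longrightarrow> c * a \<in> K" "a \<in> K \<Longrightarrow> - a \<in> K" "a \<in> K \<Longrightarrow> b \<in> K \<Longrightarrow> a - b \<in> K"
proof -
  show *: "a \<in> K \<Longrightarrow> a \<in> C" "0 \<in> K" "\<And>a b. a \<in> K \<Longrightarrow> b \<in> K \<Longrightarrow> a + b \<in> K"
    "\<And>c a. c \<in> C \<Longrightarrow> a \<in> K \<Longrightarrow> c * a \<in> K"
    using assms by (auto simp: ideal_of_def)
  show neg: "\<And>a. a \<in> K \<Longrightarrow> - a \<in> K"
    using *(4)[of "- 1"] by simp
  show "a \<in> K \<Longrightarrow> b \<in> K \<Longrightarrow> a - b \<in> K"
    using *(3)[of a "- b"] neg by simp
qed

lemma ideal_of_sum: "ideal_of K \<Longrightarrow> (\<And>j. j \<in> A \<Longrightarrow> f j \<in> K) \<Longrightarrow> sum f A \<in> K"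
  by (induction A rule: infinite_finite_induct) (auto intro: ideal_ofD)

lemma wedge_in_ideal:
  assumes "ideal_of K" "\<And>j. j \<in> F \<Longrightarrow> \<eta> j \<in> C" "\<And>j. j \<in> F \<Longrightarrow> f (F - {j}) \<in> K"
  shows "wedge \<eta> f F \<in> K"
  unfolding wedge_def using assms by (intro ideal_of_sum) (auto intro!: ideal_ofD(4)[of K])

definition adjoin :: "'a set \<Rightarrow> 'a \<Rightarrow> 'a set" where
  "adjoin K a = {k + a * c |k c. k \<in> K \<and> c \<in> C}"

lemma adjoinI: "k \<in> K \<Longrightarrow> c \<in> C \<Longrightarrow> k + a * c \<in> adjoin K a"
  by (auto simp: adjoin_def)

lemma adjoin_superset: "K \<subseteq> adjoin K a"
  using adjoinI[of _ K 0 a] by auto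

lemma ideal_of_adjoin:
  assumes K: "ideal_of K" and a: "a \<in> C"
  shows "ideal_of (adjoin K a)"
proof (rule ideal_ofI)
  show "adjoin K a \<subseteq> C"
    using a ideal_ofD(1)[OF K] by (auto simp: adjoin_def)
  show "0 \<in> adjoin K a"
    using ideal_ofD(2)[OF K] adjoin_superset by blast
  fix p assume p: "p \<in> adjoin K a"
  then obtain k c where kc: "p = k + a * c" "k \<in> K" "c \<in> C" by (auto simp: adjoin_def)
  show "p + q \<in> adjoin K a" if "q \<in> adjoin K a" for q
  proof -
    from that obtain k' c' where kc': "q = k' + a * c'" "k' \<in> K" "c' \<in> C" by (auto simp: adjoin_def)
    have "p + q = (k + k') + a * (c + c')" by (simp add: kc(1) kc'(1) algebra_simps)
    moreover have "(k + k') + a * (c + c') \<in> adjoin K a"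
      using kc kc' ideal_ofD(3)[OF K] by (intro adjoinI) auto
    ultimately show ?thesis by (simp only:)
  qed
  show "d * p \<in> adjoin K a" if "d \<in> C" for d
  proof -
    have "d * p = d * k + a * (d * c)" by (simp add: kc algebra_simps)
    then show ?thesis using kc that ideal_ofD(4)[OF K] adjoinI[of "d * k" K "d * c" a] by simp
  qed
qed

text \<open>Recursive, so that induction on the sequence can pass from \<open>K\<close> to
  \<open>adjoin K a\<close>.\<close>

fun regular_mod :: "'a set \<Rightarrow> 'a list \<Rightarrow> bool" where
  "regular_mod K [] = True"
| "regular_mod K (a # as) \<longleftrightarrow>
     a \<in> C \<and> (\<forall>f\<in>C. a * f \<in> K \<longrightarrow> f \<in> K) \<and> regular_mod (adjoin K a) as"

definition koszul_cocycle :: "(nat \<Rightarrow> 'a) \<Rightarrow> 'a set \<Rightarrow> nat \<Rightarrow> (nat set \<Rightarrow> 'a) \<Rightarrow> bool" where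
  "koszul_cocycle y K i z \<longleftrightarrow> (\<forall>F. finite F \<and> card F = Suc i \<longrightarrow> wedge y z F \<in> K)"

definition koszul_boundary :: "(nat \<Rightarrow> 'a) \<Rightarrow> 'a set \<Rightarrow> nat \<Rightarrow> (nat set \<Rightarrow> 'a) \<Rightarrow> bool" where
  "koszul_boundary y K i z \<longleftrightarrow>
     (\<exists>w. (\<forall>F. w F \<in> C) \<and> (\<forall>F. finite F \<and> card F = i \<longrightarrow> z F - wedge y w F \<in> K))"

text \<open>This is the annihilator of the class of \<open>z\<close>. Being an ideal, it contains
  powers of every element of the maximal ideal as soon as it contains the entries of
  \<open>y\<close>.\<close>

lemma ideal_of_boundary_multipliers:
  assumes K: "ideal_of K" and z: "\<And>F. z F \<in> C"
  shows "ideal_of {a \<in> C. koszul_boundary y K i (\<lambda>F. a * z F)}" (is "ideal_of ?Z")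
proof (rule ideal_ofI)
  show "?Z \<subseteq> C" by auto
  have "koszul_boundary y K i (\<lambda>F. 0)"
    unfolding koszul_boundary_def using ideal_ofD(2)[OF K]
    by (intro exI[of _ "\<lambda>F. 0"]) (simp add: wedge_zero_right)
  then show "0 \<in> ?Z" by simp
  fix a assume a: "a \<in> ?Z"
  then obtain w where w: "\<And>F. w F \<in> C" "\<And>F. finite F \<Longrightarrow> card F = i \<Longrightarrow> a * z F - wedge y w F \<in> K"
    by (auto simp: koszul_boundary_def)
  show "a + b \<in> ?Z" if b: "b \<in> ?Z" for b
  proof -
    from b obtain v where v: "\<And>F. v F \<in> C" "\<And>F. finite F \<Longrightarrow> card F = i \<Longrightarrow> b * z F - wedge y v F \<in> K"
      by (auto simp: koszul_boundary_def)
    have "koszul_boundary y K i (\<lambda>F. (a + b) * z F)"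
      unfolding koszul_boundary_def
    proof (intro exI[of _ "\<lambda>F. w F + v F"] conjI allI impI)
      fix F :: "nat set" assume "finite F \<and> card F = i"
      then have "(a * z F - wedge y w F) + (b * z F - wedge y v F) \<in> K"
        using w v by (intro ideal_ofD(3)[OF K]) auto
      then show "(a + b) * z F - wedge y (\<lambda>F. w F + v F) F \<in> K"
        by (simp add: wedge_add_right algebra_simps)
    qed (use w v in auto)
    then show ?thesis using a b by auto
  qed
  show "c * a \<in> ?Z" if c: "c \<in> C" for c
  proof -
    have "koszul_boundary y K i (\<lambda>F. (c * a) * z F)"
      unfolding koszul_boundary_def
    proof (intro exI[of _ "\<lambda>F. c * w F"] conjI allI impI)
      fix F :: "nat set" assume "finite F \<and> card F = i"
      then have "c * (a * z F - wedge y w F) \<in> K"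
        using w c by (intro ideal_ofD(4)[OF K]) auto
      then show "(c * a) * z F - wedge y (\<lambda>F. c * w F) F \<in> K"
        by (simp add: wedge_cmult_right algebra_simps)
    qed (use w c in auto)
    then show ?thesis using a c by auto
  qed
qed

text \<open>The homotopy writes \<open>y j * z\<close> as a coboundary plus the contraction of
  \<open>wedge y z\<close>, and the latter lies in \<open>K\<close>.\<close>

lemma koszul_annihilates:
  assumes K: "ideal_of K" and z: "\<And>F. z F \<in> C" and y: "y j \<in> C"
    and cyc: "koszul_cocycle y K i z"
  shows "koszul_boundary y K i (\<lambda>F. y j * z F)"
  unfolding koszul_boundary_def
proof (intro exI[of _ "contract j z"] conjI allI impI)
  show "contract j z F \<in> C" for F using z by (auto simp: contract_def)
  fix F :: "nat set" assume F: "finite F \<and> card F = i"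
  have "contract j (wedge y z) F \<in> K"
  proof (cases "j \<in> F")
    case False
    then have "wedge y z (insert j F) \<in> K"
      using F cyc by (simp add: koszul_cocycle_def)
    then show ?thesis using False ideal_ofD(4)[OF K] by (simp add: contract_def)
  qed (use ideal_ofD(2)[OF K] in \<open>simp add: contract_def\<close>)
  then show "y j * z F - wedge y (contract j z) F \<in> K"
    unfolding wedge_contract[OF conjunct1[OF F], symmetric] by simp
qed

text \<open>If \<open>a\<close> is regular modulo \<open>K\<close> and \<open>a z = d w\<close> modulo \<open>K\<close>, then \<open>w\<close> is a cocycle modulo
  \<open>K + (a)\<close> one degree lower, and \<open>z\<close> is a coboundary as soon as \<open>w\<close> is one.\<close>

theorem regular_mod_length_le:
  assumes "ideal_of K" "\<And>j. y j \<in> C" "\<And>F. z F \<in> C"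
    and "koszul_cocycle y K i z" "\<not> koszul_boundary y K i z"
    and "regular_mod K as"
    and "\<And>a. a \<in> set as \<Longrightarrow> \<exists>N. \<forall>Z. ideal_of Z \<and> range y \<subseteq> Z \<longrightarrow> a ^ N \<in> Z"
  shows "length as \<le> i"
  using assms
proof (induction as arbitrary: K i z)
  case Nil
  then show ?case by simp
next
  case (Cons a as)
  note K = \<open>ideal_of K\<close> and y = \<open>\<And>j. y j \<in> C\<close> and z = \<open>\<And>F. z F \<in> C\<close>
  have a: "a \<in> C" and reg: "\<And>f. f \<in> C \<Longrightarrow> a * f \<in> K \<Longrightarrow> f \<in> K"
    and rest: "regular_mod (adjoin K a) as"
    using Cons.prems(6) by auto
  define Z where "Z = {a \<in> C. koszul_boundary y K i (\<lambda>F. a * z F)}"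
  have "ideal_of Z"
    unfolding Z_def using K z by (rule ideal_of_boundary_multipliers)
  moreover have "range y \<subseteq> Z"
    using koszul_annihilates[OF K z y Cons.prems(4)] y by (auto simp: Z_def)
  ultimately have ex: "\<exists>N. a ^ N \<in> Z"
    using Cons.prems(7)[of a] by auto
  \<comment> \<open>Minimality gives a multiple \<open>z'\<close> of \<open>z\<close> that is not a
    coboundary although \<open>a * z'\<close> is one.\<close>
  define N where "N = (LEAST N. a ^ N \<in> Z)"
  have N: "a ^ N \<in> Z" unfolding N_def using ex by (rule LeastI_ex)
  have "N \<noteq> 0"
    using N Cons.prems(5) by (intro notI) (simp add: Z_def)
  then obtain N' where N': "N = Suc N'" by (cases N) auto
  have nb: "a ^ N' \<notin> Z" using not_less_Least[of N' "\<lambda>N. a ^ N \<in> Z"] N' by (simp add: N_def)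
  define z' where "z' F = a ^ N' * z F" for F
  have z': "z' F \<in> C" for F using a z by (simp add: z'_def)
  have z'_nb: "\<not> koszul_boundary y K i z'" using nb a by (simp add: Z_def z'_def[abs_def])
  from N obtain w where w: "\<And>F. w F \<in> C" "\<And>F. finite F \<Longrightarrow> card F = i \<Longrightarrow> a * z' F - wedge y w F \<in> K"
    by (auto simp: Z_def koszul_boundary_def N' z'_def mult.assoc)
  \<comment> \<open>In degree 0 every coboundary vanishes at the empty set, so \<open>a * z'\<close>
    lies in \<open>K\<close> and regularity would put \<open>z'\<close> into
    \<open>K\<close>.\<close>
  have "i \<noteq> 0"
  proof
    assume i: "i = 0"
    have "z' F - wedge y (\<lambda>F. 0) F \<in> K" if "finite F" "card F = i" for F
      using that i w(2)[of F] reg[of "z' F"] z' by (simp add: wedge_def)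
    then have "koszul_boundary y K i z'"
      unfolding koszul_boundary_def
      by (intro exI[of _ "\<lambda>F. 0"] conjI allI impI zero_in) auto
    with z'_nb show False by contradiction
  qed
  then obtain i' where i': "i = Suc i'" by (cases i) auto
  have K': "ideal_of (adjoin K a)" using K a by (rule ideal_of_adjoin)
  have "koszul_cocycle y (adjoin K a) i' w"
    unfolding koszul_cocycle_def
  proof (intro allI impI)
    fix F :: "nat set" assume F: "finite F \<and> card F = Suc i'"
    have "- (a * z' F - wedge y w F) + a * z' F \<in> adjoin K a"
      using w(2)[of F] F i' K z' by (intro adjoinI ideal_ofD(5)) auto
    then show "wedge y w F \<in> adjoin K a" by simp
  qed
  moreover have "\<not> koszul_boundary y (adjoin K a) i' w"
  proof
    assume "koszul_boundary y (adjoin K a) i' w"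
    then obtain w2 where w2: "\<And>F. w2 F \<in> C"
      "\<And>F. finite F \<Longrightarrow> card F = i' \<Longrightarrow> w F - wedge y w2 F \<in> adjoin K a"
      by (auto simp: koszul_boundary_def)
    have "\<exists>v. v \<in> C \<and> (finite F \<and> card F = i' \<longrightarrow> w F - wedge y w2 F - a * v \<in> K)" for F
    proof (cases "finite F \<and> card F = i'")
      case True
      then obtain k c where "w F - wedge y w2 F = k + a * c" "k \<in> K" "c \<in> C"
        using w2(2)[of F] unfolding adjoin_def by blast
      then show ?thesis by (intro exI[of _ c]) simp
    qed (use zero_in in blast)
    then obtain v where v: "\<And>F. v F \<in> C"
      "\<And>F. finite F \<Longrightarrow> card F = i' \<Longrightarrow> w F - wedge y w2 F - a * v F \<in> K"
      by metis
    have "z' F - wedge y v F \<in> K" if F: "finite F" "card F = i" for F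
    proof (rule reg)
      show "z' F - wedge y v F \<in> C" using z' v y by (intro diff_in wedge_in) auto
      \<comment> \<open>Applying the differential removes \<open>w2\<close> and leaves
        \<open>wedge y w = a * wedge y v\<close> modulo \<open>K\<close>; regularity then cancels
        \<open>a\<close>.\<close>
      have "wedge y (\<lambda>F. w F - wedge y w2 F - a * v F) F \<in> K"
        using F i' v y K by (intro wedge_in_ideal) auto
      then have "wedge y w F - a * wedge y v F \<in> K"
        by (simp add: wedge_diff_right wedge_cmult_right wedge_wedge_self)
      then have "(a * z' F - wedge y w F) + (wedge y w F - a * wedge y v F) \<in> K"
        using w(2) F by (intro ideal_ofD(3)[OF K]) auto
      then show "a * (z' F - wedge y v F) \<in> K" by (simp add: algebra_simps)
    qed
    then show False using z'_nb v by (auto simp: koszul_boundary_def)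
  qed
  ultimately have "length as \<le> i'"
    using Cons.IH[of "adjoin K a" w i'] K' y w rest Cons.prems(7) by simp
  then show ?case by (simp add: i')
qed

lemma of_nat_in [simp]: "of_nat k \<in> C"
  by (induction k) auto

text \<open>This is the radical of the ideal generated by \<open>Y\<close>, expressed through all
  ideals containing \<open>Y\<close>. For a sum, each binomial term of degree \<open>N + N'\<close>
  contains \<open>a ^ N\<close> or \<open>b ^ N'\<close>.\<close>

lemma ideal_of_eventual_powers:
  "ideal_of {a \<in> C. \<exists>N. \<forall>Z. ideal_of Z \<and> Y \<subseteq> Z \<longrightarrow> a ^ N \<in> Z}" (is "ideal_of ?R")
proof (rule ideal_ofI)
  show "0 \<in> ?R" using ideal_ofD(2) by (auto intro!: exI[of _ 1])
  show "a + b \<in> ?R" if "a \<in> ?R" "b \<in> ?R" for a b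
  proof -
    from that obtain N N' where N: "\<And>Z. ideal_of Z \<Longrightarrow> Y \<subseteq> Z \<Longrightarrow> a ^ N \<in> Z"
      and N': "\<And>Z. ideal_of Z \<Longrightarrow> Y \<subseteq> Z \<Longrightarrow> b ^ N' \<in> Z" by blast
    have ab: "a \<in> C" "b \<in> C" using that by auto
    have "(a + b) ^ (N + N') \<in> Z" if Z: "ideal_of Z" "Y \<subseteq> Z" for Z
      unfolding binomial_ring
    proof (rule ideal_of_sum[OF Z(1)])
      fix k
      show "of_nat ((N + N') choose k) * a ^ k * b ^ (N + N' - k) \<in> Z"
      proof (cases "N \<le> k")
        case True
        then have "a ^ k = a ^ (k - N) * a ^ N" by (simp flip: power_add)
        then have "of_nat ((N + N') choose k) * a ^ k * b ^ (N + N' - k) =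
            (of_nat ((N + N') choose k) * a ^ (k - N) * b ^ (N + N' - k)) * a ^ N"
          by (simp only: mult_ac)
        also have "\<dots> \<in> Z" using ab N[OF Z] by (intro ideal_ofD(4)[OF Z(1)]) auto
        finally show ?thesis .
      next
        case False
        then have "b ^ (N + N' - k) = b ^ (N - k) * b ^ N'" by (simp flip: power_add)
        then have "of_nat ((N + N') choose k) * a ^ k * b ^ (N + N' - k) =
            (of_nat ((N + N') choose k) * a ^ k * b ^ (N - k)) * b ^ N'"
          by (simp only: mult_ac)
        also have "\<dots> \<in> Z" using ab N'[OF Z] by (intro ideal_ofD(4)[OF Z(1)]) auto
        finally show ?thesis .
      qed
    qed
    then have "\<forall>Z. ideal_of Z \<and> Y \<subseteq> Z \<longrightarrow> (a + b) ^ (N + N') \<in> Z" by blast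
    then show ?thesis using ab by (intro CollectI conjI exI[of _ "N + N'"]) auto
  qed
  show "c * a \<in> ?R" if c: "c \<in> C" and a: "a \<in> ?R" for c a
  proof -
    from a obtain N where N: "\<And>Z. ideal_of Z \<Longrightarrow> Y \<subseteq> Z \<Longrightarrow> a ^ N \<in> Z" by auto
    have "(c * a) ^ N \<in> Z" if "ideal_of Z" "Y \<subseteq> Z" for Z
      using N[OF that] c that ideal_ofD(4) by (simp add: power_mult_distrib)
    then have "\<forall>Z. ideal_of Z \<and> Y \<subseteq> Z \<longrightarrow> (c * a) ^ N \<in> Z" by blast
    then show ?thesis using c a by (intro CollectI conjI exI[of _ N]) auto
  qed
qed auto

end

section \<open>Products of one-forms\<close>

definition wedges :: "(nat \<Rightarrow> 'a::comm_ring_1) list \<Rightarrow> (nat set \<Rightarrow> 'a) \<Rightarrow> nat set \<Rightarrow> 'a" where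
  "wedges \<eta>s f = foldr wedge \<eta>s f"

lemma wedges_simps [simp]:
  "wedges [] f = f" "wedges (\<eta> # \<eta>s) f = wedge \<eta> (wedges \<eta>s f)"
  by (simp_all add: wedges_def)

lemma wedges_append: "wedges (\<eta>s @ \<theta>s) f = wedges \<eta>s (wedges \<theta>s f)"
  by (induction \<eta>s) auto

definition scalar_cochain :: "'a::comm_ring_1 \<Rightarrow> nat set \<Rightarrow> 'a" where
  "scalar_cochain u F = (if F = {} then u else 0)"

lemma wedges_add: "wedges \<eta>s (\<lambda>F. f F + g F) = (\<lambda>F. wedges \<eta>s f F + wedges \<eta>s g F)"
proof (induction \<eta>s)
  case (Cons \<eta> \<eta>s)
  then show ?case by (auto simp: wedge_add_right)
qed simp

lemma wedge_wedges_swap: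
  "wedges \<eta>s (wedge \<omega> f) F = (- 1) ^ length \<eta>s * wedge \<omega> (wedges \<eta>s f) F"
proof (induction \<eta>s arbitrary: F)
  case (Cons \<eta> \<eta>s)
  have "wedges \<eta>s (wedge \<omega> f) = (\<lambda>F. (- 1) ^ length \<eta>s * wedge \<omega> (wedges \<eta>s f) F)"
    using Cons.IH by blast
  then have "wedges (\<eta> # \<eta>s) (wedge \<omega> f) F = (- 1) ^ length \<eta>s * wedge \<eta> (wedge \<omega> (wedges \<eta>s f)) F"
    by (simp only: wedges_simps wedge_cmult_right)
  then show ?case by (simp add: wedge_anticommute[of \<eta> \<omega>])
qed simp

lemma wedge_wedges_mem:
  assumes "\<theta> \<in> set \<eta>s"
  shows "wedge \<theta> (wedges \<eta>s f) F = 0"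
  using assms
proof (induction \<eta>s arbitrary: F)
  case (Cons \<eta> \<eta>s)
  show ?case
  proof (cases "\<theta> = \<eta>")
    case False
    then have "wedge \<theta> (wedges \<eta>s f) = (\<lambda>F. 0)" using Cons by auto
    then show ?thesis
      using wedge_anticommute[of \<theta> \<eta> "wedges \<eta>s f" F] by (simp add: wedge_zero_right)
  qed (simp add: wedge_wedge_self)
qed simp

lemma wedges_scalar_eq_0:
  assumes "a \<in> F" "\<And>\<eta>. \<eta> \<in> set \<eta>s \<Longrightarrow> \<eta> a = 0"
  shows "wedges \<eta>s (scalar_cochain u) F = 0"
  using assms
proof (induction \<eta>s arbitrary: F)
  case Nil
  then show ?case by (auto simp: scalar_cochain_def)
next
  case (Cons \<eta> \<eta>s)
  have "\<eta> j = 0 \<or> wedges \<eta>s (scalar_cochain u) (F - {j}) = 0" for j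
    using Cons.prems by (cases "j = a") (auto intro: Cons.IH)
  then have "ksgn j F * \<eta> j * wedges \<eta>s (scalar_cochain u) (F - {j}) = 0" for j
    by (metis mult_zero_left mult_zero_right)
  then show ?case by (simp add: wedge_def)
qed

fun triangular :: "('b \<Rightarrow> 'b \<Rightarrow> 'a::zero) \<Rightarrow> 'b list \<Rightarrow> bool" where
  "triangular \<xi> [] = True"
| "triangular \<xi> (f # fs) \<longleftrightarrow>
     ((\<forall>k\<in>set fs. \<xi> f k = 0) \<or> (\<forall>k\<in>set fs. \<xi> k f = 0)) \<and> triangular \<xi> fs"

text \<open>Up to sign this is a determinant. Expansion along \<open>f\<close> leaves the diagonal
  term: either the rest of row \<open>f\<close> vanishes, or the other minors contain the zero
  column \<open>f\<close>.\<close>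

lemma wedges_triangular:
  fixes \<xi> :: "nat \<Rightarrow> nat \<Rightarrow> 'a::comm_ring_1"
  assumes "distinct fs" "triangular \<xi> fs"
  shows "wedges (map \<xi> fs) (scalar_cochain u) (set fs) \<in>
    {(\<Prod>k\<in>set fs. \<xi> k k) * u, - ((\<Prod>k\<in>set fs. \<xi> k k) * u)}"
  using assms
proof (induction fs)
  case Nil
  then show ?case by (simp add: scalar_cochain_def)
next
  case (Cons f fs)
  define g where "g = wedges (map \<xi> fs) (scalar_cochain u)"
  have F: "set (f # fs) = insert f (set fs)" and f: "f \<notin> set fs" using Cons.prems by auto
  have zero: "ksgn j (set (f # fs)) * \<xi> f j * g (set (f # fs) - {j}) = 0" if j: "j \<in> set fs" for j
  proof (cases "\<forall>k\<in>set fs. \<xi> f k = 0")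
    case True
    then show ?thesis using j by simp
  next
    case False
    then have "\<And>\<eta>. \<eta> \<in> set (map \<xi> fs) \<Longrightarrow> \<eta> f = 0" using Cons.prems by auto
    moreover have "f \<in> set (f # fs) - {j}" using f j by auto
    ultimately have "g (set (f # fs) - {j}) = 0" unfolding g_def by (intro wedges_scalar_eq_0)
    then show ?thesis by simp
  qed
  have "wedges (map \<xi> (f # fs)) (scalar_cochain u) (set (f # fs)) =
      (\<Sum>j\<in>insert f (set fs). ksgn j (set (f # fs)) * \<xi> f j * g (set (f # fs) - {j}))"
    by (simp add: wedge_def g_def)
  also have "\<dots> = ksgn f (set (f # fs)) * \<xi> f f * g (set (f # fs) - {f})"
    using f zero by (subst sum.insert) simp_all
  also have "set (f # fs) - {f} = set fs" using f by auto
  finally have eq: "wedges (map \<xi> (f # fs)) (scalar_cochain u) (set (f # fs)) =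
      ksgn f (set (f # fs)) * \<xi> f f * g (set fs)" .
  have "g (set fs) \<in> {(\<Prod>k\<in>set fs. \<xi> k k) * u, - ((\<Prod>k\<in>set fs. \<xi> k k) * u)}"
    unfolding g_def using Cons by auto
  moreover have "(\<Prod>k\<in>set (f # fs). \<xi> k k) = \<xi> f f * (\<Prod>k\<in>set fs. \<xi> k k)"
    using f by simp
  moreover have "s * x * v \<in> {x * p * u, - (x * p * u)}"
    if "s = 1 \<or> s = - 1" "v \<in> {p * u, - (p * u)}" for s x v p :: 'a
    using that by (auto simp: mult.assoc)
  moreover have "(ksgn f (set (f # fs)) :: 'a) = 1 \<or> (ksgn f (set (f # fs)) :: 'a) = - 1"
    by (rule ksgn_cases)
  ultimately show ?case
    unfolding eq by simp
qed

text \<open>A product of one-forms is a signed sum over all ways of picking one coefficient from each.\<close>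

lemma wedges_closed:
  fixes \<xi> :: "nat \<Rightarrow> nat \<Rightarrow> 'a::comm_ring_1"
  assumes N: "0 \<in> N" "\<And>a b. a \<in> N \<Longrightarrow> b \<in> N \<Longrightarrow> a + b \<in> N" "\<And>a. a \<in> N \<Longrightarrow> - a \<in> N"
    and "distinct fs" "finite G"
    and "\<And>c F. finite F \<Longrightarrow> card F + length fs = card G \<Longrightarrow> s * (\<Prod>k\<in>set fs. \<xi> k (c k)) * g F \<in> N"
  shows "s * wedges (map \<xi> fs) g G \<in> N"
  using assms(4-)
proof (induction fs arbitrary: s G)
  case Nil
  then show ?case by simp
next
  case (Cons f fs)
  define h where "h = wedges (map \<xi> fs) g"
  have sumN: "sum t A \<in> N" if "\<And>j. j \<in> A \<Longrightarrow> t j \<in> N" for t :: "nat \<Rightarrow> 'a" and A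
    using that by (induction A rule: infinite_finite_induct) (auto intro: N)
  have "s * \<xi> f j * h (G - {j}) \<in> N" if j: "j \<in> G" for j
    unfolding h_def
  proof (rule Cons.IH)
    show "distinct fs" "finite (G - {j})" using Cons.prems by auto
    fix c F assume F: "finite (F :: nat set)" "card F + length fs = card (G - {j})"
    have "card F + length (f # fs) = card G"
      using F(2) card_Suc_Diff1[OF Cons.prems(2) j] by simp
    then have "s * (\<Prod>k\<in>set (f # fs). \<xi> k ((c(f := j)) k)) * g F \<in> N"
      using F Cons.prems(3) by blast
    moreover have "(\<Prod>k\<in>set fs. \<xi> k ((c(f := j)) k)) = (\<Prod>k\<in>set fs. \<xi> k (c k))"
      using Cons.prems(1) by (intro prod.cong) auto
    then have "(\<Prod>k\<in>set (f # fs). \<xi> k ((c(f := j)) k)) = \<xi> f j * (\<Prod>k\<in>set fs. \<xi> k (c k))"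
      using Cons.prems(1) by simp
    ultimately show "s * \<xi> f j * (\<Prod>k\<in>set fs. \<xi> k (c k)) * g F \<in> N"
      by (simp only: mult.assoc)
  qed
  then have "ksgn j G * (s * \<xi> f j * h (G - {j})) \<in> N" if "j \<in> G" for j
  proof -
    have "(ksgn j G :: 'a) = 1 \<or> (ksgn j G :: 'a) = - 1" by (rule ksgn_cases)
    then show ?thesis using that \<open>\<And>j. j \<in> G \<Longrightarrow> s * \<xi> f j * h (G - {j}) \<in> N\<close> N(3) by auto
  qed
  then have "(\<Sum>j\<in>G. ksgn j G * (s * \<xi> f j * h (G - {j}))) \<in> N" by (rule sumN)
  then show ?case
    by (simp add: wedge_def sum_distrib_left mult_ac flip: h_def)
qed

context coefficient_ring
begin

lemma wedges_in:
  "(\<And>\<eta> j. \<eta> \<in> set \<eta>s \<Longrightarrow> \<eta> j \<in> C) \<Longrightarrow> (\<And>F. f F \<in> C) \<Longrightarrow> wedges \<eta>s f F \<in> C"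
  by (induction \<eta>s arbitrary: F) (auto intro!: wedge_in)

text \<open>The cocycle is the product of the one-forms indexed by \<open>Q\<close>. Multiplying it by those indexed by
  \<open>P\<close> would send a coboundary to an element of \<open>N\<close> in top degree.\<close>

theorem koszul_nonvanishing:
  fixes \<xi> :: "nat \<Rightarrow> nat \<Rightarrow> 'a"
  assumes K: "ideal_of K" and y: "\<And>j. y j \<in> C" and \<xi>: "\<And>k j. \<xi> k j \<in> C" and u: "u \<in> C"
    and fin: "finite P" "finite Q" and disj: "P \<inter> Q = {}"
    and yQ: "\<And>j. y j = (\<Sum>k\<in>Q. b k * \<xi> k j) + \<rho> j"
    and QK: "\<And>c j. \<rho> j * ((\<Prod>k\<in>Q. \<xi> k (c k)) * u) \<in> K"
    and yP: "\<And>j. y j = (\<Sum>k\<in>P. b' k * \<xi> k j) + \<rho>' j"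
    and N: "0 \<in> N" "\<And>a b. a \<in> N \<Longrightarrow> b \<in> N \<Longrightarrow> a + b \<in> N" "\<And>a. a \<in> N \<Longrightarrow> - a \<in> N"
    and \<rho>'N: "\<And>j h. h \<in> C \<Longrightarrow> \<rho>' j * h \<in> N"
    and PN: "\<And>c i. i \<in> K \<Longrightarrow> (\<Prod>k\<in>P. \<xi> k (c k)) * i \<in> N"
    and top: "(\<Prod>k\<in>P \<union> Q. \<xi> k k) * u \<notin> N"
    and triP: "\<And>p. p \<in> P \<Longrightarrow> (\<forall>k\<in>P \<union> Q - {p}. \<xi> p k = 0) \<or> (\<forall>k\<in>P \<union> Q - {p}. \<xi> k p = 0)"
    and triQ: "\<And>p k. p \<in> Q \<Longrightarrow> k \<in> Q \<Longrightarrow> k \<noteq> p \<Longrightarrow> \<xi> p k = 0"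
  shows "\<exists>z. (\<forall>F. z F \<in> C) \<and> koszul_cocycle y K (card Q) z \<and> \<not> koszul_boundary y K (card Q) z"
proof -
  obtain ps where ps: "set ps = P" "distinct ps" using fin finite_distinct_list by blast
  obtain qs where qs: "set qs = Q" "distinct qs" using fin finite_distinct_list by blast
  have len: "length ps = card P" "length qs = card Q"
    using ps qs distinct_card by fastforce+
  define z where "z = wedges (map \<xi> qs) (scalar_cochain u)"
  have z: "z F \<in> C" for F
    unfolding z_def using \<xi> u by (intro wedges_in) (auto simp: scalar_cochain_def)
  have "koszul_cocycle y K (card Q) z"
    unfolding koszul_cocycle_def
  proof (intro allI impI)
    fix F :: "nat set" assume F: "finite F \<and> card F = Suc (card Q)"
    \<comment> \<open>A form that already occurs in \<open>z\<close> annihilates it, so only the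
      remainder \<open>\<rho>\<close> of \<open>y\<close> survives.\<close>
    have "wedge (\<xi> k) z F = 0" if "k \<in> Q" for k
      unfolding z_def using that qs by (intro wedge_wedges_mem) auto
    moreover have "wedge y z F = (\<Sum>k\<in>Q. b k * wedge (\<xi> k) z F) + wedge \<rho> z F"
      unfolding yQ[abs_def] by (simp add: wedge_add_left wedge_sum_left wedge_cmult_left)
    ultimately have eq: "wedge y z F = wedge \<rho> z F" by simp
    have "\<rho> j * z G \<in> K" if "finite G" for j G
      unfolding z_def
    proof (rule wedges_closed)
      show "\<rho> j * (\<Prod>k\<in>set qs. \<xi> k (c k)) * scalar_cochain u F \<in> K" for c F
        using QK[of j c] ideal_ofD(2)[OF K] by (simp add: scalar_cochain_def qs mult.assoc)
    qed (use K qs that in \<open>auto intro: ideal_ofD\<close>)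
    then have "ksgn j F * (\<rho> j * z (F - {j})) \<in> K" for j
      using F by (auto intro!: ideal_ofD(4)[OF K ksgn_in])
    then show "wedge y z F \<in> K"
      by (subst eq, unfold wedge_def) (intro ideal_of_sum[OF K], simp add: mult.assoc)
  qed
  moreover have "\<not> koszul_boundary y K (card Q) z"
  proof
    assume "koszul_boundary y K (card Q) z"
    then obtain w where w: "\<And>F. w F \<in> C"
      "\<And>F. finite F \<Longrightarrow> card F = card Q \<Longrightarrow> z F - wedge y w F \<in> K"
      by (auto simp: koszul_boundary_def)
    define W where "W = wedges (map \<xi> ps)"
    let ?V = "P \<union> Q"
    have cV: "card ?V = card P + card Q" "finite ?V" using fin disj by (auto simp: card_Un_disjoint)
    have "1 * W (\<lambda>F. z F - wedge y w F) ?V \<in> N"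
      unfolding W_def
    proof (rule wedges_closed)
      fix c F assume "finite (F :: nat set)" "card F + length ps = card ?V"
      then have "z F - wedge y w F \<in> K" using w(2) cV len by simp
      then show "1 * (\<Prod>k\<in>set ps. \<xi> k (c k)) * (z F - wedge y w F) \<in> N"
        using PN by (simp add: ps)
    qed (use N ps cV in auto)
    \<comment> \<open>Moving \<open>y\<close> to the front costs a sign. There its part in the forms
      of \<open>P\<close> is annihilated, and the remainder stays in \<open>N\<close>.\<close>
    moreover have "W (wedge y w) ?V \<in> N"
    proof -
      have "wedge (\<xi> k) (W w) ?V = 0" if "k \<in> P" for k
        unfolding W_def using that ps by (intro wedge_wedges_mem) auto
      then have "wedge y (W w) ?V = wedge \<rho>' (W w) ?V"
        unfolding yP[abs_def] by (simp add: wedge_add_left wedge_sum_left wedge_cmult_left)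
      moreover have WC: "W w F \<in> C" for F
        unfolding W_def using \<xi> w by (intro wedges_in) auto
      have "\<rho>' j * (ksgn j ?V * W w (?V - {j})) \<in> N" for j
        using WC by (intro \<rho>'N) auto
      then have *: "ksgn j ?V * \<rho>' j * W w (?V - {j}) \<in> N" for j
        by (simp only: mult_ac)
      have sumN: "sum t A \<in> N" if "\<And>j. t j \<in> N" for t :: "nat \<Rightarrow> 'a" and A
        using that by (induction A rule: infinite_finite_induct) (auto intro: N)
      have "wedge \<rho>' (W w) ?V \<in> N"
        unfolding wedge_def by (rule sumN) (rule *)
      ultimately have "wedge y (W w) ?V \<in> N" by simp
      then have "(- 1) ^ length (map \<xi> ps) * wedge y (W w) ?V \<in> N"
        using N(3) by (cases "even (length (map \<xi> ps))") auto
      then show ?thesis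
        unfolding W_def wedge_wedges_swap .
    qed
    moreover have "W z = (\<lambda>F. W (\<lambda>F. z F - wedge y w F) F + W (wedge y w) F)"
      unfolding W_def wedges_add[symmetric] by simp
    ultimately have in_N: "W z ?V \<in> N" using N(2) by simp
    \<comment> \<open>The forms of \<open>P\<close> come first: each has its row or its column clear
      of all other indices, whereas those of \<open>Q\<close> are diagonal only among
      themselves.\<close>
    have tri: "triangular \<xi> (ps @ qs)" "distinct (ps @ qs)" "set (ps @ qs) = ?V"
    proof -
      have triq: "triangular \<xi> rs" if "set rs \<subseteq> Q" "distinct rs" for rs
        using that
      proof (induction rs)
        case (Cons p rs)
        then have "\<forall>k\<in>set rs. \<xi> p k = 0" by (auto intro!: triQ)
        then show ?case using Cons by simp
      qed simp
      have "triangular \<xi> (rs @ qs)" if "set rs \<subseteq> P" "distinct rs" for rs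
        using that
      proof (induction rs)
        case Nil
        then show ?case using triq[of qs] qs by simp
      next
        case (Cons p rs)
        have "set (rs @ qs) \<subseteq> ?V - {p}" using Cons.prems disj qs by auto
        then show ?case using Cons triP[of p] by auto
      qed
      then show "triangular \<xi> (ps @ qs)" using ps by simp
    qed (use ps qs disj in auto)
    have "W z ?V \<in> {(\<Prod>k\<in>?V. \<xi> k k) * u, - ((\<Prod>k\<in>?V. \<xi> k k) * u)}"
      using wedges_triangular[OF tri(2,1), of u] unfolding tri(3) W_def z_def by (simp add: wedges_append)
    then show False using in_N top N(3)[of "W z ?V"] by auto
  qed
  ultimately show ?thesis using z by blast
qed

end

section \<open>Regular sequences on a cyclic module\<close>

lemma (in module) submoduleI':
  assumes "N \<subseteq> carrier M" "\<zero>\<^bsub>M\<^esub> \<in> N"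
    and "\<And>x y. x \<in> N \<Longrightarrow> y \<in> N \<Longrightarrow> x \<oplus>\<^bsub>M\<^esub> y \<in> N"
    and smult: "\<And>a x. a \<in> carrier R \<Longrightarrow> x \<in> N \<Longrightarrow> a \<odot>\<^bsub>M\<^esub> x \<in> N"
  shows "submodule N R M"
proof (rule submoduleI)
  fix x assume x: "x \<in> N"
  have "(\<ominus> \<one>) \<odot>\<^bsub>M\<^esub> x = \<ominus>\<^bsub>M\<^esub> x"
    using x assms(1) smult_l_minus[of \<one> x] by auto
  then show "\<ominus>\<^bsub>M\<^esub> x \<in> N" using smult[of "\<ominus> \<one>" x] x by simp
qed (use assms in auto)

lemma (in module) submodule_ideal_smult:
  assumes "A \<subseteq> carrier R"
  shows "submodule (ideal_smult R A M) R M"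
proof (rule submoduleI')
  have "submodule (carrier M) R M \<and> (\<forall>a\<in>A. \<forall>x\<in>carrier M. a \<odot>\<^bsub>M\<^esub> x \<in> carrier M)"
    using carrier_is_submodule assms by auto
  then show "ideal_smult R A M \<subseteq> carrier M" unfolding ideal_smult_def by blast
  show "\<zero>\<^bsub>M\<^esub> \<in> ideal_smult R A M"
    unfolding ideal_smult_def using subgroup.one_closed[OF submodule.axioms(1)] by fastforce
qed (auto simp: ideal_smult_def intro: submoduleE(4,5))

lemma (in module) regular_element_quotD:
  assumes N: "submodule N R M" and reg: "regular_element R (quot_module M N) a"
    and x: "x \<in> carrier M" and ax: "a \<odot>\<^bsub>M\<^esub> x \<in> N"
  shows "x \<in> N"
proof -
  interpret N: submodule N R M by fact
  interpret A: abelian_subgroup N M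
    by (rule abelian_subgroupI3) (use N.subgroup_axioms M.abelian_group_axioms in \<open>auto simp: additive_subgroup_def\<close>)
  have a: "a \<in> carrier R" using reg by (simp add: regular_element_def)
  have "N +>\<^bsub>M\<^esub> (a \<odot>\<^bsub>M\<^esub> y) = N" if y: "y \<in> N +>\<^bsub>M\<^esub> x" for y
  proof -
    from y obtain h where h: "h \<in> N" "y = h \<oplus>\<^bsub>M\<^esub> x" by (auto simp: a_r_coset_def')
    then have "a \<odot>\<^bsub>M\<^esub> y = a \<odot>\<^bsub>M\<^esub> h \<oplus>\<^bsub>M\<^esub> a \<odot>\<^bsub>M\<^esub> x"
      using a x A.a_subset by (auto simp: smult_r_distr)
    then have "a \<odot>\<^bsub>M\<^esub> y \<in> N" using h a ax by (simp add: A.a_closed)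
    then show ?thesis by (simp add: A.a_rcos_const)
  qed
  then have "a \<odot>\<^bsub>quot_module M N\<^esub> (N +>\<^bsub>M\<^esub> x) = \<zero>\<^bsub>quot_module M N\<^esub>"
    using A.a_rcos_self[OF x] by (auto simp: quot_module_def)
  moreover have "N +>\<^bsub>M\<^esub> x \<in> carrier (quot_module M N)"
    using x by (auto simp: quot_module_def A_RCOSETS_def')
  ultimately have "N +>\<^bsub>M\<^esub> x = N"
    using reg by (auto simp: regular_element_def quot_module_def)
  then show ?thesis using A.a_rcos_self[OF x] by simp
qed

lemma (in cring) cring_idealI:
  assumes "B \<subseteq> carrier R" "\<zero> \<in> B" "\<And>a b. a \<in> B \<Longrightarrow> b \<in> B \<Longrightarrow> a \<oplus> b \<in> B"
    and mult: "\<And>a x. a \<in> B \<Longrightarrow> x \<in> carrier R \<Longrightarrow> x \<otimes> a \<in> B"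
  shows "ideal B R"
proof (rule idealI)
  show "subgroup B (add_monoid R)"
  proof (rule add.subgroupI)
    show "\<ominus> f \<in> B" if "f \<in> B" for f
      using mult[of f "\<ominus> \<one>"] that assms(1) by (auto simp: l_minus)
  qed (use assms in auto)
  show "a \<otimes> x \<in> B" if "a \<in> B" "x \<in> carrier R" for a x
    using mult[OF that] that assms(1) m_comm[of a x] by auto
qed (use assms ring_axioms in auto)

locale cyclic_module = cring R + I: ideal I R for R (structure) and I +
  fixes M
  defines M_def: "M \<equiv> quot_module (self_module R) I"
begin

sublocale module R M
proof -
  interpret module R "self_module R" by (rule module_self_module)
  show "module R M"
    unfolding M_def by (intro module_quot_module I.submodule_self_module)
qed

lemma coset_self_module: "I +>\<^bsub>self_module R\<^esub> f = I +> f"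
  by (simp add: a_r_coset_def' self_module_def)

lemma carrier_M: "carrier M = (\<lambda>f. I +> f) ` carrier R"
  by (auto simp: M_def quot_module_def A_RCOSETS_def' coset_self_module) (auto simp: self_module_def)

lemma zero_M: "\<zero>\<^bsub>M\<^esub> = I"
  by (simp add: M_def quot_module_def)

lemma coset_eq_iff: "f \<in> carrier R \<Longrightarrow> g \<in> carrier R \<Longrightarrow> I +> f = I +> g \<longleftrightarrow> f \<ominus> g \<in> I"
  by (rule quotient_eq_iff_same_a_r_cos[symmetric]) (use I.is_ideal in auto)

lemma add_M: "f \<in> carrier R \<Longrightarrow> g \<in> carrier R \<Longrightarrow> (I +> f) \<oplus>\<^bsub>M\<^esub> (I +> g) = I +> (f \<oplus> g)"
  using I.a_rcos_sum[of f g] by (simp add: M_def quot_module_def set_add_def set_mult_def self_module_def)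

lemma smult_M:
  assumes a: "a \<in> carrier R" and f: "f \<in> carrier R"
  shows "a \<odot>\<^bsub>M\<^esub> (I +> f) = I +> (a \<otimes> f)"
proof -
  have "I +> (a \<otimes> g) = I +> (a \<otimes> f)" if "g \<in> I +> f" for g
  proof -
    from that obtain h where h: "h \<in> I" "g = h \<oplus> f" by (auto simp: a_r_coset_def')
    then have "h \<in> carrier R" by simp
    then have "a \<otimes> g \<ominus> a \<otimes> f = a \<otimes> h" using a f h by algebra
    then show ?thesis using a f h by (subst coset_eq_iff) (auto simp: I.I_l_closed)
  qed
  moreover have "I +> f \<noteq> {}" using f I.a_rcos_self by blast
  ultimately have "(\<Union>g\<in>I +> f. I +> (a \<otimes> g)) = I +> (a \<otimes> f)" by blast
  then show ?thesis
    by (simp add: M_def quot_module_def coset_self_module) (simp add: self_module_def)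
qed

lemma coset_mem_iff:
  assumes B: "ideal B R" "I \<subseteq> B" and f: "f \<in> carrier R"
  shows "I +> f \<in> (\<lambda>g. I +> g) ` B \<longleftrightarrow> f \<in> B"
proof
  interpret B: ideal B R by fact
  assume "I +> f \<in> (\<lambda>g. I +> g) ` B"
  then obtain g where g: "g \<in> B" "I +> f = I +> g" by auto
  then have gc: "g \<in> carrier R" by simp
  then have "f \<ominus> g \<in> B" using g f B(2) coset_eq_iff by blast
  then have "(f \<ominus> g) \<oplus> g \<in> B" using g by (simp add: B.a_closed)
  moreover have "(f \<ominus> g) \<oplus> g = f" using f gc by algebra
  ultimately show "f \<in> B" by simp
qed auto

lemma submodule_image:
  assumes B: "ideal B R" "I \<subseteq> B"
  shows "submodule ((\<lambda>g. I +> g) ` B) R M"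
proof (rule submoduleI')
  interpret B: ideal B R by fact
  have Bc: "b \<in> carrier R" if "b \<in> B" for b using that by simp
  show "(\<lambda>g. I +> g) ` B \<subseteq> carrier M" using Bc by (auto simp: carrier_M)
  have "I +> \<zero> = I" by (rule I.a_rcos_const) (rule I.zero_closed)
  then show "\<zero>\<^bsub>M\<^esub> \<in> (\<lambda>g. I +> g) ` B" using B.zero_closed unfolding zero_M by force
  show "x \<oplus>\<^bsub>M\<^esub> y \<in> (\<lambda>g. I +> g) ` B" if "x \<in> (\<lambda>g. I +> g) ` B" "y \<in> (\<lambda>g. I +> g) ` B" for x y
    using that Bc by (auto simp: add_M intro: B.a_closed)
  show "a \<odot>\<^bsub>M\<^esub> x \<in> (\<lambda>g. I +> g) ` B" if "a \<in> carrier R" "x \<in> (\<lambda>g. I +> g) ` B" for a x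
    using that Bc by (auto simp: smult_M intro: B.I_l_closed)
qed

lemma ideal_preimage:
  assumes N: "submodule N R M"
  shows "ideal {f \<in> carrier R. I +> f \<in> N} R" (is "ideal ?B R")
proof (rule cring_idealI)
  show "\<zero> \<in> ?B"
    using subgroup.one_closed[OF submodule.axioms(1)[OF N]] I.a_rcos_const[OF I.zero_closed]
    by (simp add: zero_M)
  show "f \<oplus> g \<in> ?B" if "f \<in> ?B" "g \<in> ?B" for f g
    using that submoduleE(5)[OF N, of "I +> f" "I +> g"] by (simp add: add_M)
  show "a \<otimes> f \<in> ?B" if "f \<in> ?B" "a \<in> carrier R" for a f
    using that smult_M[of a f] submoduleE(4)[OF N, of a "I +> f"] by simp
qed auto

text \<open>Submodules of R/I correspond to ideals containing I. This turns regularity on the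
  quotient module into a statement about ring elements.\<close>

lemma mem_ideal_smult_iff:
  assumes X: "X \<subseteq> carrier R" and f: "f \<in> carrier R"
  shows "I +> f \<in> ideal_smult R (Idl X) M \<longleftrightarrow> f \<in> Idl (I \<union> X)"
proof
  have sub: "I \<union> X \<subseteq> carrier R" using X by auto
  have B: "ideal (Idl (I \<union> X)) R" "I \<subseteq> Idl (I \<union> X)" "X \<subseteq> Idl (I \<union> X)"
    using genideal_ideal[OF sub] genideal_self[OF sub] by auto
  interpret B: ideal "Idl (I \<union> X)" R by (rule B)
  {
    assume "I +> f \<in> ideal_smult R (Idl X) M"
    moreover have "Idl X \<subseteq> Idl (I \<union> X)" using B by (intro genideal_minimal)
    then have "\<forall>a\<in>Idl X. \<forall>x\<in>carrier M. a \<odot>\<^bsub>M\<^esub> x \<in> (\<lambda>g. I +> g) ` (Idl (I \<union> X))"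
      using B.a_subset by (auto simp: carrier_M smult_M subset_iff intro!: imageI B.I_r_closed)
    ultimately have "I +> f \<in> (\<lambda>g. I +> g) ` (Idl (I \<union> X))"
      using submodule_image[OF B(1,2)] by (auto simp: ideal_smult_def)
    then show "f \<in> Idl (I \<union> X)" using coset_mem_iff B f by blast
  next
    assume fB: "f \<in> Idl (I \<union> X)"
    show "I +> f \<in> ideal_smult R (Idl X) M"
      unfolding ideal_smult_def
    proof safe
      fix N assume N: "submodule N R M" and XN: "\<forall>a\<in>Idl X. \<forall>x\<in>carrier M. a \<odot>\<^bsub>M\<^esub> x \<in> N"
      have "I +> x \<in> N" if "x \<in> X" for x
      proof -
        have "x \<in> carrier R" "x \<in> Idl X" using that X genideal_self[OF X] by auto
        then have "x \<odot>\<^bsub>M\<^esub> (I +> \<one>) \<in> N" using XN by (auto simp: carrier_M)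
        then show ?thesis using smult_M[of x \<one>] \<open>x \<in> carrier R\<close> by simp
      qed
      moreover have "I +> i \<in> N" if "i \<in> I" for i
        using that subgroup.one_closed[OF submodule.axioms(1)[OF N]] I.a_rcos_const zero_M by simp
      ultimately have "I \<union> X \<subseteq> {f \<in> carrier R. I +> f \<in> N}" using sub by auto
      then have "Idl (I \<union> X) \<subseteq> {f \<in> carrier R. I +> f \<in> N}"
        by (intro genideal_minimal ideal_preimage[OF N])
      then show "I +> f \<in> N" using fB by auto
    qed
  }
qed

lemma regular_sequenceD:
  assumes "regular_sequence R M xs" "set xs \<subseteq> carrier R" "i < length xs"
    and f: "f \<in> carrier R" "xs ! i \<otimes> f \<in> Idl (I \<union> set (take i xs))"
  shows "f \<in> Idl (I \<union> set (take i xs))"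
proof -
  have tk: "set (take i xs) \<subseteq> carrier R" using assms(2) set_take_subset by fastforce
  have xi: "xs ! i \<in> carrier R" using assms(2,3) by auto
  let ?N = "ideal_smult R (Idl (set (take i xs))) M"
  have "regular_element R (quot_module M ?N) (xs ! i)"
    using assms(1,3) by (simp add: regular_sequence_def)
  moreover have "(xs ! i) \<odot>\<^bsub>M\<^esub> (I +> f) \<in> ?N"
    using mem_ideal_smult_iff[OF tk] f xi by (simp add: smult_M)
  ultimately have "I +> f \<in> ?N"
    using regular_element_quotD[OF submodule_ideal_smult] genideal_ideal[OF tk] f
    by (auto simp: carrier_M ideal.Icarr subsetI)
  then show ?thesis using mem_ideal_smult_iff[OF tk f(1)] by simp
qed

text \<open>Since \<open>Idl X\<close> contains \<open>I\<close> but not 1, the module differs from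
  its multiple by \<open>Idl X\<close>, and \<open>depth\<close> is a supremum of lengths instead of
  \<infinity>.\<close>

lemma depth_le:
  assumes X: "X \<subseteq> carrier R" and proper: "I \<subseteq> Idl X" "\<one> \<notin> Idl X"
    and bound: "\<And>xs. set xs \<subseteq> Idl X \<Longrightarrow>
      (\<And>i f. i < length xs \<Longrightarrow> f \<in> carrier R \<Longrightarrow> xs ! i \<otimes> f \<in> Idl (I \<union> set (take i xs))
          \<Longrightarrow> f \<in> Idl (I \<union> set (take i xs))) \<Longrightarrow> length xs \<le> d"
  shows "depth R (Idl X) M \<le> enat d"
proof -
  have XI: "ideal (Idl X) R" by (rule genideal_ideal[OF X])
  have "Idl (I \<union> X) \<subseteq> Idl X"
    using proper X genideal_self[OF X] by (intro genideal_minimal[OF XI]) auto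
  then have "I +> \<one> \<notin> ideal_smult R (Idl X) M"
    using mem_ideal_smult_iff[OF X, of \<one>] proper by auto
  then have ne: "ideal_smult R (Idl X) M \<noteq> carrier M" by (auto simp: carrier_M)
  have "Idl X \<subseteq> carrier R" using XI by (simp add: ideal.Icarr subsetI)
  then have "length xs \<le> d" if "set xs \<subseteq> Idl X" "regular_sequence R M xs" for xs
    using that regular_sequenceD[OF that(2)] by (intro bound) auto
  then show ?thesis
    using ne by (auto simp: depth_def intro!: SUP_least)
qed

end

section \<open>Monomials in the polynomial ring\<close>

abbreviation poly_carrier :: "nat \<Rightarrow> 'k::field mpoly set" where
  "poly_carrier n \<equiv> carrier (poly_ring n)"

lemma poly_ring_simps [simp]:
  "(\<oplus>\<^bsub>poly_ring n\<^esub>) = (+)" "(\<otimes>\<^bsub>poly_ring n\<^esub>) = (*)" "\<zero>\<^bsub>poly_ring n\<^esub> = 0" "\<one>\<^bsub>poly_ring n\<^esub> = 1"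
  by (simp_all add: poly_ring_def)

interpretation poly: cring "poly_ring n :: 'k::field mpoly ring" for n
  by (rule cring_poly_ring)

lemma uminus_poly_carrier: "p \<in> poly_carrier n \<Longrightarrow> - p \<in> poly_carrier n"
  by (simp add: poly_ring_def)

interpretation poly: coefficient_ring "poly_carrier n :: 'k::field mpoly set" for n
proof
  show "a + b \<in> poly_carrier n" if "a \<in> poly_carrier n" "b \<in> poly_carrier n" for a b :: "'k mpoly"
    using poly.add.m_closed[OF that] by simp
  show "a * b \<in> poly_carrier n" if "a \<in> poly_carrier n" "b \<in> poly_carrier n" for a b :: "'k mpoly"
    using poly.m_closed[OF that] by simp
qed (use poly.zero_closed poly.one_closed uminus_poly_carrier in auto)

lemma ideal_of_iff: "poly.ideal_of n K \<longleftrightarrow> ideal K (poly_ring n)"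
proof
  assume K: "poly.ideal_of n K"
  note D = poly.ideal_ofD[OF K]
  show "ideal K (poly_ring n)"
  by (rule poly.cring_idealI) (use D in auto)
next
  assume "ideal K (poly_ring n)"
  then interpret K: ideal K "poly_ring n" .
  show "poly.ideal_of n K"
    using K.a_subset K.zero_closed K.a_closed K.I_l_closed by (intro poly.ideal_ofI) auto
qed

text \<open>Adjoining \<open>x\<close> to \<open>K\<close> first and the remaining elements later
  generates the same ideal as all of them at once; this matches the recursion with prefixes of a
  list.\<close>

lemma regular_modI:
  assumes "ideal K (poly_ring n)" "set xs \<subseteq> poly_carrier n"
    and "\<And>i f. i < length xs \<Longrightarrow> f \<in> poly_carrier n \<Longrightarrow>
      xs ! i * f \<in> genideal (poly_ring n) (K \<union> set (take i xs)) \<Longrightarrow>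
      f \<in> genideal (poly_ring n) (K \<union> set (take i xs))"
  shows "poly.regular_mod n K xs"
  using assms
proof (induction xs arbitrary: K)
  case Nil
  then show ?case by simp
next
  case (Cons x xs)
  let ?gen = "genideal (poly_ring n)"
  have x: "x \<in> poly_carrier n" using Cons.prems by auto
  have K': "ideal (poly.adjoin n K x) (poly_ring n)"
    using poly.ideal_of_adjoin Cons.prems(1) x ideal_of_iff by blast
  have Kc: "K \<subseteq> poly_carrier n" using Cons.prems(1) by (simp add: ideal.Icarr subsetI)
  have K0: "0 \<in> K" using Cons.prems(1) ideal_of_iff poly.ideal_ofD(2) by blast
  have eq: "?gen (poly.adjoin n K x \<union> set ys) = ?gen (K \<union> set (x # ys))"
    if ys: "set ys \<subseteq> poly_carrier n" for ys
  proof (rule subset_antisym)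
    have s1: "poly.adjoin n K x \<union> set ys \<subseteq> poly_carrier n"
      using ys K' by (simp add: ideal.Icarr subset_iff)
    have s2: "K \<union> set (x # ys) \<subseteq> poly_carrier n" using ys x Kc by auto
    have i1: "ideal (?gen (poly.adjoin n K x \<union> set ys)) (poly_ring n)"
      by (rule poly.genideal_ideal[OF s1])
    have i2: "ideal (?gen (K \<union> set (x # ys))) (poly_ring n)"
      by (rule poly.genideal_ideal[OF s2])
    note D = poly.ideal_ofD[OF iffD2[OF ideal_of_iff i2]]
    show "?gen (poly.adjoin n K x \<union> set ys) \<subseteq> ?gen (K \<union> set (x # ys))"
    proof (rule poly.genideal_minimal[OF i2])
      have "k + x * c \<in> ?gen (K \<union> set (x # ys))" if "k \<in> K" "c \<in> poly_carrier n" for k c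
        using poly.genideal_self[OF s2] that D(3) D(4)[of c x] by (auto simp: mult.commute)
      then show "poly.adjoin n K x \<union> set ys \<subseteq> ?gen (K \<union> set (x # ys))"
        using poly.genideal_self[OF s2] by (auto simp: poly.adjoin_def)
    qed
    show "?gen (K \<union> set (x # ys)) \<subseteq> ?gen (poly.adjoin n K x \<union> set ys)"
    proof (rule poly.genideal_minimal[OF i1])
      have "x \<in> poly.adjoin n K x" using poly.adjoinI[OF K0 poly.one_in, of x] by simp
      then show "K \<union> set (x # ys) \<subseteq> ?gen (poly.adjoin n K x \<union> set ys)"
        using poly.genideal_self[OF s1] poly.adjoin_superset[of K n x] by auto
    qed
  qed
  have "f \<in> K" if "f \<in> poly_carrier n" "x * f \<in> K" for f
  proof -
    have "?gen K = K"
      using Cons.prems(1) Kc poly.genideal_minimal[OF Cons.prems(1), of K] poly.genideal_self[OF Kc] by auto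
    then show ?thesis using Cons.prems(3)[of 0 f] that by simp
  qed
  moreover have "poly.regular_mod n (poly.adjoin n K x) xs"
  proof (rule Cons.IH[OF K'])
    show "set xs \<subseteq> poly_carrier n" using Cons.prems by auto
    fix i f assume i: "i < length xs" "f \<in> poly_carrier n"
      "xs ! i * f \<in> ?gen (poly.adjoin n K x \<union> set (take i xs))"
    have "set (take i xs) \<subseteq> poly_carrier n"
      using Cons.prems set_take_subset[of i xs] by auto
    then show "f \<in> ?gen (poly.adjoin n K x \<union> set (take i xs))"
      using Cons.prems(3)[of "Suc i" f] i eq[of "take i xs"] by simp
  qed
  ultimately show ?case using x by auto
qed

abbreviation monom_of :: "(nat \<Rightarrow>\<^sub>0 nat) \<Rightarrow> 'k::field mpoly" where
  "monom_of e \<equiv> Poly_Mapping.single e 1"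

lemma mon_add: "monom_of (a + b) = monom_of a * monom_of b"
  by (simp add: mult_single)

lemma prod_monom_of: "(\<Prod>k\<in>A. monom_of (f k)) = monom_of (\<Sum>k\<in>A. f k)"
  by (induction A rule: infinite_finite_induct) (simp_all add: mon_add)

lemma mon_in_poly_carrier: "monom_of e \<in> poly_carrier n \<longleftrightarrow> Poly_Mapping.keys e \<subseteq> {1..n}"
  by (simp add: poly_ring_def)

section \<open>Windows and the powers of the path ideal\<close>

definition window :: "nat \<Rightarrow> nat \<Rightarrow> nat \<Rightarrow> nat \<Rightarrow>\<^sub>0 nat" where
  "window n m i = (\<Sum>j\<in>{i..<i + m}. Poly_Mapping.single (cyc_index n j) 1)"

text \<open>For \<open>e\<close> supported in \<open>{1..n}\<close> this is membership of its
  monomial in the t-th power of the path ideal, by \<open>windows_divide_keys\<close> and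
  \<open>mon_in_cycle_path_power\<close>.\<close>

definition windows_divide :: "nat \<Rightarrow> nat \<Rightarrow> nat \<Rightarrow> (nat \<Rightarrow>\<^sub>0 nat) \<Rightarrow> bool" where
  "windows_divide n m t e \<longleftrightarrow>
     (\<exists>ws. length ws = t \<and> set ws \<subseteq> {1..n} \<and>
       (\<forall>p. (\<Sum>i\<leftarrow>ws. Poly_Mapping.lookup (window n m i) p) \<le> Poly_Mapping.lookup e p))"

lemma windows_divide_add:
  assumes "windows_divide n m s d" "windows_divide n m t e"
  shows "windows_divide n m (s + t) (d + e)"
proof -
  obtain ws ws' where "length ws = s" "set ws \<subseteq> {1..n}"
    "\<And>p. (\<Sum>i\<leftarrow>ws. Poly_Mapping.lookup (window n m i) p) \<le> Poly_Mapping.lookup d p"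
    "length ws' = t" "set ws' \<subseteq> {1..n}"
    "\<And>p. (\<Sum>i\<leftarrow>ws'. Poly_Mapping.lookup (window n m i) p) \<le> Poly_Mapping.lookup e p"
    using assms by (auto simp: windows_divide_def)
  then show ?thesis
    unfolding windows_divide_def by (intro exI[of _ "ws @ ws'"]) (auto simp: lookup_add intro: add_mono)
qed

lemma windows_divide_0: "windows_divide n m 0 e"
  by (auto simp: windows_divide_def)

lemma prod_var_eq: "(\<Prod>j\<in>{i..<i + m}. var (cyc_index n j)) = monom_of (window n m i)"
  by (simp add: var_def prod_monom_of window_def)

lemma monomial_ideal:
  assumes "\<And>d e. U e \<Longrightarrow> U (d + e)"
  shows "ideal {p \<in> poly_carrier n. \<forall>e\<in>Poly_Mapping.keys p. U e} (poly_ring n)" (is "ideal ?I _")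
proof (rule poly.cring_idealI)
  show "a \<oplus>\<^bsub>poly_ring n\<^esub> b \<in> ?I" if "a \<in> ?I" "b \<in> ?I" for a b
    using that Poly_Mapping.keys_add[of a b] by auto
  show "x \<otimes>\<^bsub>poly_ring n\<^esub> a \<in> ?I" if "a \<in> ?I" "x \<in> poly_carrier n" for a x
    using that keys_mult[of x a] assms by fastforce
qed auto

lemma cyc_index_id: "1 \<le> j \<Longrightarrow> j \<le> n \<Longrightarrow> cyc_index n j = j"
  by (simp add: cyc_index_def)

lemma cyc_index_range: "1 \<le> n \<Longrightarrow> cyc_index n j \<in> {1..n}"
  using mod_less_divisor[of n "j - 1"] unfolding cyc_index_def atLeastAtMost_iff by linarith

lemma keys_window: "1 \<le> n \<Longrightarrow> Poly_Mapping.keys (window n m i) \<subseteq> {1..n}"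
proof -
  assume n: "1 \<le> n"
  have "Poly_Mapping.keys (\<Sum>j\<in>A. Poly_Mapping.single (cyc_index n j) (1::nat)) \<subseteq> {1..n}" for A :: "nat set"
    by (induction A rule: infinite_finite_induct)
      (use cyc_index_range[OF n] keys_add in \<open>fastforce+\<close>)
  then show ?thesis by (simp add: window_def)
qed

context
  fixes n m :: nat
  assumes n: "1 \<le> n"
begin

lemma ideal_cycle_path_power:
  "ideal (cycle_path_ideal n m [^]\<^bsub>ideals_set (poly_ring n)\<^esub> (t :: nat)) (poly_ring n :: 'k::field mpoly ring)"
proof -
  interpret ideals: comm_monoid "ideals_set (poly_ring n :: 'k mpoly ring)"
    by (rule poly.ideals_set_is_comm_monoid)
  have "(cycle_path_ideal n m :: 'k mpoly set) \<in> carrier (ideals_set (poly_ring n))"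
    using ideal_cycle_path_ideal[OF n] by (simp add: ideals_set_def)
  from ideals.nat_pow_closed[OF this] show ?thesis by (simp add: ideals_set_def)
qed

lemma cycle_path_power_Suc:
  "(cycle_path_ideal n m [^]\<^bsub>ideals_set (poly_ring n)\<^esub> Suc t :: 'k::field mpoly set) =
   ideal_prod (poly_ring n) (cycle_path_ideal n m [^]\<^bsub>ideals_set (poly_ring n)\<^esub> t) (cycle_path_ideal n m)"
proof -
  interpret ideals: comm_monoid "ideals_set (poly_ring n :: 'k mpoly ring)"
    by (rule poly.ideals_set_is_comm_monoid)
  show ?thesis unfolding ideals.nat_pow_Suc by (simp add: ideals_set_def)
qed

text \<open>Polynomials whose exponents all satisfy an upward closed condition form an ideal, so for
  t = 1 the generators suffice; each further factor is absorbed by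
  \<open>windows_divide_add\<close>.\<close>

lemma windows_divide_keys:
  assumes "p \<in> (cycle_path_ideal n m [^]\<^bsub>ideals_set (poly_ring n)\<^esub> t :: 'k::field mpoly set)"
    and "e \<in> Poly_Mapping.keys p"
  shows "windows_divide n m t e"
  using assms
proof (induction t arbitrary: p e)
  case 0
  then show ?case by (simp add: windows_divide_0)
next
  case (Suc t)
  have gen: "windows_divide n m 1 e" if "p \<in> cycle_path_ideal n m" "e \<in> Poly_Mapping.keys p"
    for p :: "'k mpoly" and e
  proof -
    let ?I = "{p \<in> poly_carrier n. \<forall>e\<in>Poly_Mapping.keys p. windows_divide n m 1 e} :: 'k mpoly set"
    have "ideal ?I (poly_ring n)"
      by (rule monomial_ideal) (use windows_divide_add[OF windows_divide_0] in fastforce)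
    moreover have "windows_divide n m 1 (window n m i)" if "i \<in> {1..n}" for i
      using that unfolding windows_divide_def by (intro exI[of _ "[i]"]) auto
    then have "(\<lambda>i. \<Prod>j\<in>{i..<i + m}. var (cyc_index n j)) ` {1..n} \<subseteq> ?I"
      using keys_window[OF n] by (auto simp: prod_var_eq mon_in_poly_carrier)
    ultimately have "cycle_path_ideal n m \<subseteq> ?I"
      unfolding cycle_path_ideal_def by (rule poly.genideal_minimal)
    then show ?thesis using that by auto
  qed
  show ?case
    using Suc.prems unfolding cycle_path_power_Suc
  proof (induction p arbitrary: e rule: ideal_prod.induct)
    case (prod i j)
    then obtain a b where "e = a + b" "a \<in> Poly_Mapping.keys i" "b \<in> Poly_Mapping.keys j"
      using keys_mult[of i j] by auto
    then show ?case
      using windows_divide_add[OF Suc.IH[of i a] gen[of j b]] prod by simp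
  next
    case (sum s1 s2)
    then show ?case using Poly_Mapping.keys_add[of s1 s2] by auto
  qed
qed

lemma mon_in_cycle_path_power:
  assumes "windows_divide n m t e" "Poly_Mapping.keys e \<subseteq> {1..n}"
  shows "monom_of e \<in> (cycle_path_ideal n m [^]\<^bsub>ideals_set (poly_ring n)\<^esub> t :: 'k::field mpoly set)"
proof -
  let ?J = "cycle_path_ideal n m :: 'k mpoly set"
  let ?pow = "\<lambda>t. ?J [^]\<^bsub>ideals_set (poly_ring n)\<^esub> (t :: nat)"
  have gen: "monom_of (window n m i) \<in> ?J" if "i \<in> {1..n}" for i
  proof -
    have "(\<lambda>i. \<Prod>j\<in>{i..<i + m}. var (cyc_index n j)) ` {1..n} \<subseteq> (poly_carrier n :: 'k mpoly set)"
      using keys_window[OF n] by (auto simp: prod_var_eq mon_in_poly_carrier)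
    from poly.genideal_self[OF this] show ?thesis
      using that unfolding cycle_path_ideal_def by (auto simp: prod_var_eq)
  qed
  have prod: "monom_of (\<Sum>i\<leftarrow>ws. window n m i) \<in> ?pow (length ws)" if "set ws \<subseteq> {1..n}" for ws
    using that
  proof (induction ws)
    case Nil
    then show ?case using poly.one_closed by (simp add: ideals_set_def)
  next
    case (Cons i ws)
    then have "monom_of (\<Sum>i\<leftarrow>ws. window n m i) \<otimes>\<^bsub>poly_ring n\<^esub> monom_of (window n m i) \<in> ?pow (Suc (length ws))"
      unfolding cycle_path_power_Suc by (intro ideal_prod.prod gen) auto
    then show ?case by (simp add: mult_single add.commute)
  qed
  from assms obtain ws where ws: "length ws = t" "set ws \<subseteq> {1..n}"
    "\<And>p. (\<Sum>i\<leftarrow>ws. Poly_Mapping.lookup (window n m i) p) \<le> Poly_Mapping.lookup e p"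
    by (auto simp: windows_divide_def)
  define d where "d = (\<Sum>i\<leftarrow>ws. window n m i)"
  have d: "Poly_Mapping.lookup d p = (\<Sum>i\<leftarrow>ws. Poly_Mapping.lookup (window n m i) p)" for p
    unfolding d_def by (induction ws) (auto simp: lookup_add)
  have e: "e = (e - d) + d"
    by (rule poly_mapping_eqI) (use ws(3) d in \<open>simp add: lookup_add lookup_minus\<close>)
  have "Poly_Mapping.keys (e - d) \<subseteq> {1..n}"
    using assms(2) by (auto simp: in_keys_iff lookup_minus subset_iff)
  then have "monom_of (e - d) \<otimes>\<^bsub>poly_ring n\<^esub> monom_of d \<in> ?pow t"
    using prod[OF ws(2)] ws(1) unfolding d_def[symmetric]
    by (intro ideal.I_l_closed[OF ideal_cycle_path_power]) (auto simp: mon_in_poly_carrier)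
  then show ?thesis by (subst e) (simp add: mult_single)
qed

end

lemma max_ideal_eventual_powers:
  assumes "a \<in> max_ideal n" "\<And>j. j \<in> {1..n} \<Longrightarrow> \<exists>k. var j ^ k \<in> Y"
  shows "\<exists>N. \<forall>Z. poly.ideal_of n Z \<and> Y \<subseteq> Z \<longrightarrow> a ^ N \<in> Z"
proof -
  let ?R = "{a \<in> poly_carrier n. \<exists>N. \<forall>Z. poly.ideal_of n Z \<and> Y \<subseteq> Z \<longrightarrow> a ^ N \<in> Z}"
  have "ideal ?R (poly_ring n)"
    using poly.ideal_of_eventual_powers ideal_of_iff by blast
  moreover have "var ` {1..n} \<subseteq> ?R" using assms(2) var_closed by blast
  ultimately have "max_ideal n \<subseteq> ?R" unfolding max_ideal_def by (rule poly.genideal_minimal)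
  then show ?thesis using assms(1) by auto
qed

lemma max_ideal_proper:
  assumes "p \<in> max_ideal n"
  shows "0 \<notin> Poly_Mapping.keys p"
proof -
  let ?I = "{p \<in> poly_carrier n. \<forall>e\<in>Poly_Mapping.keys p. e \<noteq> 0}"
  have "ideal ?I (poly_ring n)"
    by (rule monomial_ideal) (auto simp: poly_mapping_eq_iff lookup_add fun_eq_iff)
  moreover have "var ` {1..n} \<subseteq> ?I"
  proof
    fix x assume "x \<in> var ` {1..n}"
    then obtain i where i: "x = var i" "i \<in> {1..n}" by auto
    have "Poly_Mapping.single i (1::nat) \<noteq> 0" by (metis lookup_single_eq lookup_zero one_neq_zero)
    then show "x \<in> ?I" using i var_closed[of i n] by (simp add: var_def)
  qed
  ultimately have "max_ideal n \<subseteq> ?I" unfolding max_ideal_def by (rule poly.genideal_minimal)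
  then show ?thesis using assms by auto
qed

section \<open>Transversals of the residue classes\<close>

definition ind :: "nat set \<Rightarrow> nat \<Rightarrow>\<^sub>0 nat" where
  "ind A = (\<Sum>j\<in>A. Poly_Mapping.single j 1)"

lemma lookup_ind: "finite A \<Longrightarrow> Poly_Mapping.lookup (ind A) p = of_bool (p \<in> A)"
  by (simp add: ind_def lookup_sum lookup_single when_def)

lemma window_eq_ind: "1 \<le> i \<Longrightarrow> i + m \<le> n + 1 \<Longrightarrow> window n m i = ind {i..<i + m}"
  unfolding window_def ind_def by (intro sum.cong) (auto simp: cyc_index_id)

lemma bij_betw_exchange:
  assumes bij: "bij_betw f T B" and "b \<in> T" "f a = f b"
  shows "bij_betw f (insert a (T - {b})) B"
proof -
  have inj: "inj_on f T" and img: "f ` T = B" using bij by (auto simp: bij_betw_def)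
  have "f b \<notin> f ` (T - {b})" using inj assms(2) by (auto simp: inj_on_def)
  moreover have "inj_on f (T - {b})" using inj by (rule inj_on_subset) auto
  ultimately have inj': "inj_on f (insert a (T - {b}))" using assms(3) by (auto simp: inj_on_insert)
  have "f ` (insert a (T - {b})) = f ` (insert b (T - {b}))" using assms(3) by (simp only: image_insert)
  also have "insert b (T - {b}) = T" using assms(2) by auto
  also note img
  finally have "f ` (insert a (T - {b})) = B" .
  with inj' show ?thesis by (simp add: bij_betw_def)
qed

text \<open>Write \<open>w\<^sub>i\<close> for the product of the variables with index in \<open>{i..<i + m}\<close>. Since
  \<open>w\<^bsub>s\<^esub> x\<^bsub>s+m\<^esub> = x\<^bsub>s\<^esub> w\<^bsub>s+1\<^esub>\<close>, a transversal can be pushed into a shorter interval.\<close>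

lemma transversal_windows:
  assumes "1 \<le> m" "1 \<le> s" "T \<subseteq> {1..s + m}" "bij_betw (\<lambda>x. x mod m) T {..<m}"
  shows "\<exists>ws. length ws = s \<and> set ws \<subseteq> {1..s + 1} \<and>
    (\<Sum>i\<in>{2..s}. ind {i..<i + m}) + ind T = (\<Sum>i\<leftarrow>ws. ind {i..<i + m})"
  using assms(2-4)
proof (induction s arbitrary: T rule: nat_induct_at_least)
  case base
  \<comment> \<open>Among 1, ..., m + 1 only 1 and m + 1 are congruent, so the transversals are the
    two windows starting at 1 and at 2.\<close>
  have full: "T' = {1..m}" if "T' \<subseteq> {1..m}" "bij_betw (\<lambda>x. x mod m) T' {..<m}" for T' :: "nat set"
    using that bij_betw_same_card[OF that(2)] by (intro card_subset_eq) auto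
  show ?case
  proof (cases "m + 1 \<in> T")
    case False
    then have "T = {1..m}" using base by (intro full) (auto simp: le_Suc_eq)
    then have "T = {1..<1 + m}" by auto
    then show ?thesis by (intro exI[of _ "[1]"]) simp
  next
    case True
    let ?T = "insert 1 (T - {m + 1})"
    have cong: "1 mod m = (m + 1) mod m" by (simp only: mod_add_self1)
    have bij: "bij_betw (\<lambda>x. x mod m) ?T {..<m}"
      using bij_betw_exchange[OF base(2) True cong] .
    have one: "1 \<notin> T"
    proof
      assume "1 \<in> T"
      then have "1 = m + 1"
        using inj_onD[OF bij_betw_imp_inj_on[OF base(2)] cong _ True] by blast
      then show False using assms(1) by simp
    qed
    have "?T = {1..m}" using base bij assms(1) by (intro full) (auto simp: le_Suc_eq)
    then have "T = insert (m + 1) ({1..m} - {1})" using True one assms(1) by auto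
    also have "\<dots> = {2..<2 + m}" using assms(1) by auto
    finally show ?thesis by (intro exI[of _ "[2]"]) simp
  qed
next
  case (Suc s)
  have split: "(\<Sum>i\<in>{2..Suc s}. ind {i..<i + m}) = (\<Sum>i\<in>{2..s}. ind {i..<i + m}) + ind {s + 1..<s + 1 + m}"
    using Suc.hyps by simp
  have fin: "finite T" using Suc.prems(1) finite_subset by blast
  show ?case
  proof (cases "Suc s + m \<in> T")
    case False
    then have "T \<subseteq> {1..s + m}" using Suc.prems by (auto simp: le_Suc_eq)
    from Suc.IH[OF this Suc.prems(2)] obtain ws where ws: "length ws = s" "set ws \<subseteq> {1..s + 1}"
      "(\<Sum>i\<in>{2..s}. ind {i..<i + m}) + ind T = (\<Sum>i\<leftarrow>ws. ind {i..<i + m})" by blast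
    show ?thesis
      using ws(1,2) unfolding split
      by (intro exI[of _ "ws @ [s + 1]"]) (auto simp: ws(3)[symmetric] add_ac)
  next
    case True
    \<comment> \<open>The index \<open>s + 1\<close> is congruent to \<open>Suc s + m\<close>, so it
      is missing from \<open>T\<close> and can replace it; in exchange the window at
      \<open>s + 1\<close> becomes the one at \<open>s + 2\<close>.\<close>
    let ?T = "insert (s + 1) (T - {Suc s + m})"
    have cong: "(s + 1) mod m = (Suc s + m) mod m" by (simp only: mod_add_self2 Suc_eq_plus1)
    have bij: "bij_betw (\<lambda>x. x mod m) ?T {..<m}"
      using bij_betw_exchange[OF Suc.prems(2) True cong] .
    have notin: "s + 1 \<notin> T"
    proof
      assume "s + 1 \<in> T"
      then have "s + 1 = Suc s + m"
        using inj_onD[OF bij_betw_imp_inj_on[OF Suc.prems(2)] cong _ True] by blast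
      then show False using assms(1) by simp
    qed
    have "?T \<subseteq> {1..s + m}" using Suc.prems assms(1) by (auto simp: le_Suc_eq)
    from Suc.IH[OF this bij] obtain ws where ws: "length ws = s" "set ws \<subseteq> {1..s + 1}"
      "(\<Sum>i\<in>{2..s}. ind {i..<i + m}) + ind ?T = (\<Sum>i\<leftarrow>ws. ind {i..<i + m})" by blast
    have "ind {s + 1..<s + 1 + m} + ind T = ind ?T + ind {s + 2..<s + 2 + m}"
    proof (rule poly_mapping_eqI)
      fix p
      show "Poly_Mapping.lookup (ind {s + 1..<s + 1 + m} + ind T) p =
          Poly_Mapping.lookup (ind ?T + ind {s + 2..<s + 2 + m}) p"
        using True notin fin assms(1)
        by (cases "p = s + 1"; cases "p = Suc s + m") (auto simp: lookup_add lookup_ind of_bool_def)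
    qed
    then have "(\<Sum>i\<in>{2..Suc s}. ind {i..<i + m}) + ind T
        = (\<Sum>i\<in>{2..s}. ind {i..<i + m}) + ind ?T + ind {s + 2..<s + 2 + m}"
      unfolding split by (simp add: add.assoc)
    then show ?thesis
      using ws(1,2) unfolding ws(3)
      by (intro exI[of _ "ws @ [s + 2]"]) auto
  qed
qed

lemma mod_inj_on_window:
  assumes "x \<in> {i..<i + m}" "y \<in> {i..<i + m}" "x mod m = y mod m"
  shows "x = (y :: nat)"
proof -
  have *: "x = y" if "x \<le> y" "x \<in> {i..<i + m}" "y \<in> {i..<i + m}" "x mod m = y mod m" for x y :: nat
  proof -
    have "m dvd y - x" using that mod_eq_dvd_iff_nat[of x y m] by simp
    then show ?thesis using that nat_dvd_not_less[of "y - x" m] by force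
  qed
  show ?thesis
  proof (cases "x \<le> y")
    case True
    then show ?thesis using *[of x y] assms by blast
  next
    case False
    then have "y = x" using *[of y x] assms by simp
    then show ?thesis by simp
  qed
qed

lemma bij_betw_mod_window:
  assumes "1 \<le> m"
  shows "bij_betw (\<lambda>x. x mod m) {i..<i + m} {..<(m :: nat)}"
proof -
  have inj: "inj_on (\<lambda>x. x mod m) {i..<i + m}"
    using mod_inj_on_window[where i = i and m = m] unfolding inj_on_def by blast
  then have "card ((\<lambda>x. x mod m) ` {i..<i + m}) = m" by (simp add: card_image)
  then have "(\<lambda>x. x mod m) ` {i..<i + m} = {..<m}"
    using assms by (intro card_subset_eq) auto
  then show ?thesis using inj by (simp add: bij_betw_def)
qed

lemma window_meets_class:
  assumes "1 \<le> m"
  shows "\<exists>x\<in>{i..<i + m}. x mod m = a mod (m :: nat)"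
proof -
  have "a mod m \<in> (\<lambda>x. x mod m) ` {i..<i + m}"
    using bij_betw_mod_window[OF assms, of i] assms by (simp add: bij_betw_def)
  then show ?thesis by auto
qed

lemma sum_eq_single:
  assumes "finite S" "\<And>k. k \<in> S \<Longrightarrow> k \<noteq> a \<Longrightarrow> f k = 0"
  shows "sum f S = (if a \<in> S then f a else 0)"
proof -
  have "sum f S = (\<Sum>k\<in>S. if k = a then f k else 0)" using assms(2) by (intro sum.cong) auto
  then show ?thesis using assms(1) by simp
qed

section \<open>A nonvanishing Koszul class for the powers of the path ideal\<close>

text \<open>The indices \<open>{1..t0 + m}\<close> are grouped by residue classes modulo \<open>m\<close>. From \<open>t0\<close> on, the indices
  are divided into \<open>q\<close> blocks of length \<open>m + 1\<close>: the simplex boundary of a block lives on its first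
  \<open>m\<close> indices (the first one in \<open>H\<close>, the others in \<open>F\<close>), and the last one separates it from the next
  block. The remaining indices are either all put into \<open>R\<close> and contribute a factor \<open>e\<^sub>j\<close> each
  (\<open>K = 1\<close>), or there are \<open>m\<close> of them and all but \<open>n\<close> contribute \<open>x\<^sub>j e\<^sub>j\<close> to a cochain for the
  sequence containing \<open>x\<^sub>j\<^sup>2\<close> (\<open>K = 2\<close>), so that multiplication by \<open>x\<^sub>n\<close> gives a full window.\<close>

locale koszul_config =
  fixes n m t t0 q K :: nat and R :: "nat set"
  assumes m: "2 \<le> m" and t0: "1 \<le> t0" "t0 \<le> t" and q: "1 \<le> q"
    and n: "t0 + q * (m + 1) \<le> n + 1"
    and tail: "K = 1 \<and> R = {t0 + q * (m + 1)..n} \<or>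
      K = 2 \<and> n + 1 = t0 + q * (m + 1) + m \<and> R = {t0 + q * (m + 1)..<n}"
begin

definition pos :: "nat \<Rightarrow> nat \<Rightarrow> nat" where
  "pos l c = t0 + l * (m + 1) + c"

definition H :: "nat set" where
  "H = (\<lambda>l. pos l 0) ` {..<q}"

definition F :: "nat set" where
  "F = (\<lambda>(l, c). pos l c) ` ({..<q} \<times> {1..<m})"

text \<open>The summand \<open>(m - 1) * t0\<close> stands for \<open>- t0\<close> modulo \<open>m\<close>.\<close>

definition rep_of :: "nat \<Rightarrow> nat" where
  "rep_of j = (if j \<le> t0 + m then t0 + (j + (m - 1) * t0) mod m else j)"

text \<open>The windows at 2, ..., \<open>t0\<close> are the factors that
  \<open>transversal_windows\<close> consumes; copies of the first window fill up to t - 1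
  factors.\<close>

definition u :: "nat \<Rightarrow>\<^sub>0 nat" where
  "u = (\<Sum>i\<in>{2..t0}. ind {i..<i + m}) + (\<Sum>i<t - t0. ind {1..<1 + m})"

text \<open>The forms of \<open>H\<close> run over the m vertices of a simplex and multiply to the
  sphere. Those of \<open>F\<close> run over a residue class on the initial interval and over a
  single vertex later; with those of \<open>R\<close> they multiply to the cocycle.\<close>

definition supports :: "nat \<Rightarrow> nat \<Rightarrow> bool" where
  "supports k j \<longleftrightarrow>
     (if k \<in> H then k \<le> j \<and> j < k + m else if k \<in> F then j \<in> {1..n} \<and> rep_of j = k else j = k)"

text \<open>A form of \<open>R\<close> carries the power K - 1 of its variable, one below the power
  K in \<open>y\<close>: so \<open>y\<close> is a multiple of it, yet the top monomial is not
  divisible by that entry of \<open>y\<close>.\<close>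

definition weight :: "nat \<Rightarrow> nat \<Rightarrow> nat \<Rightarrow>\<^sub>0 nat" where
  "weight k j =
     (if k \<in> H \<union> F then Poly_Mapping.single j 1 else if k \<in> R then Poly_Mapping.single k (K - 1) else 0)"

definition \<xi> :: "nat \<Rightarrow> nat \<Rightarrow> 'k::field mpoly" where
  "\<xi> k j = (if supports k j then monom_of (weight k j) else 0)"

definition y :: "nat \<Rightarrow> 'k::field mpoly" where
  "y j = (if j \<in> {1..n} then monom_of (Poly_Mapping.single j (if j \<in> R then K else 1)) else 0)"

abbreviation P :: "nat set" where
  "P \<equiv> {1..n} - (F \<union> R)"

lemma pos_eq_iff:
  assumes "c \<le> m" "c' \<le> m"
  shows "pos l c = pos l' c' \<longleftrightarrow> l = l' \<and> c = c'"
proof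
  assume "pos l c = pos l' c'"
  then have eq: "l * (m + 1) + c = l' * (m + 1) + c'" by (simp add: pos_def)
  have "(l * (m + 1) + c) div (m + 1) = l" if "c \<le> m" for l c
  proof -
    have "(l * (m + 1) + c) div (m + 1) = l + c div (m + 1)" by (rule div_mult_self3) simp
    then show ?thesis using that by simp
  qed
  then have "(l * (m + 1) + c) div (m + 1) = l" "(l' * (m + 1) + c') div (m + 1) = l'"
    using assms by blast+
  then have "l = l'" using eq by simp
  then show "l = l' \<and> c = c'" using eq by simp
qed simp

lemma pos_less:
  assumes "l < q" "c \<le> m"
  shows "pos l c < t0 + q * (m + 1)"
proof -
  have "(l + 1) * (m + 1) \<le> q * (m + 1)" using assms by (intro mult_le_mono1) simp
  then show ?thesis using assms by (simp add: pos_def)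
qed

lemma pos_cases:
  assumes "t0 \<le> j" "j < t0 + q * (m + 1)"
  obtains l c where "l < q" "c \<le> m" "j = pos l c"
proof
  have "j - t0 < q * (m + 1)" using assms by simp
  then show "(j - t0) div (m + 1) < q" by (simp add: less_mult_imp_div_less)
  show "(j - t0) mod (m + 1) \<le> m" using mod_less_divisor[of "m + 1" "j - t0"] by linarith
  have "j - t0 = (j - t0) div (m + 1) * (m + 1) + (j - t0) mod (m + 1)" by (rule div_mult_mod_eq[symmetric])
  then show "j = pos ((j - t0) div (m + 1)) ((j - t0) mod (m + 1))"
    unfolding pos_def using assms(1) by linarith
qed

lemma pos_0: "pos 0 c = t0 + c"
  by (simp add: pos_def)

lemma pos_ge: "l \<noteq> 0 \<Longrightarrow> t0 + m < pos l c"
  by (cases l) (simp_all add: pos_def)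

lemma E_less: "t0 + m < t0 + q * (m + 1)"
  using pos_less[of 0 m] q by (simp add: pos_0)

lemma E_le_n: "t0 + m \<le> n"
  using E_less n by simp

lemma R_ge: "k \<in> R \<Longrightarrow> t0 + q * (m + 1) \<le> k"
  using tail by auto

lemma R_le: "k \<in> R \<Longrightarrow> k \<le> n"
  using tail by auto

lemma H_I: "l < q \<Longrightarrow> pos l 0 \<in> H"
  by (auto simp: H_def)

lemma H_E:
  assumes "k \<in> H"
  obtains l where "l < q" "k = pos l 0"
  using assms by (auto simp: H_def)

lemma F_I: "l < q \<Longrightarrow> 1 \<le> c \<Longrightarrow> c < m \<Longrightarrow> pos l c \<in> F"
  by (auto simp: F_def)

lemma F_E:
  assumes "k \<in> F"
  obtains l c where "l < q" "1 \<le> c" "c < m" "k = pos l c"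
  using assms by (auto simp: F_def)

lemma pos_mem_H: "c \<le> m \<Longrightarrow> pos l c \<in> H \<Longrightarrow> c = 0"
  by (elim H_E) (simp add: pos_eq_iff)

lemma pos_mem_F: "c \<le> m \<Longrightarrow> pos l c \<in> F \<Longrightarrow> 1 \<le> c \<and> c < m"
  by (elim F_E) (simp add: pos_eq_iff)

lemma H_bounds: "k \<in> H \<Longrightarrow> t0 \<le> k \<and> k + m < t0 + q * (m + 1)"
proof (elim H_E)
  fix l assume "l < q" "k = pos l 0"
  then show ?thesis using pos_less[of l m] by (simp add: pos_def)
qed

lemma F_bounds: "k \<in> F \<Longrightarrow> t0 < k \<and> k < t0 + q * (m + 1)"
proof (elim F_E)
  fix l c assume "l < q" "1 \<le> c" "c < m" "k = pos l c"
  then show ?thesis using pos_less[of l c] by (simp add: pos_def)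
qed

lemma H_F_disjoint: "k \<in> H \<Longrightarrow> k \<in> F \<Longrightarrow> False"
  by (elim H_E) (use pos_mem_F[of 0] in auto)

lemma H_R_disjoint: "k \<in> H \<Longrightarrow> k \<in> R \<Longrightarrow> False"
  using H_bounds[of k] R_ge[of k] by simp

lemma F_R_disjoint: "k \<in> F \<Longrightarrow> k \<in> R \<Longrightarrow> False"
  using F_bounds[of k] R_ge[of k] by simp

lemma F_subset: "F \<subseteq> {1..n}"
  using F_bounds t0 n by fastforce

lemma R_subset: "R \<subseteq> {1..n}"
  using R_ge R_le t0 by fastforce

lemma H_subset: "H \<subseteq> P"
  using H_bounds t0 n H_F_disjoint H_R_disjoint by fastforce

lemma finite_F: "finite F" and finite_R: "finite R"
  using F_subset R_subset finite_subset by blast+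

lemma t0_in_H: "t0 \<in> H"
  using H_I[of 0] q by (simp add: pos_0)

lemma card_F: "card F = q * (m - 1)"
proof -
  have "inj_on (\<lambda>(l, c). pos l c) ({..<q} \<times> {1..<m})"
    by (auto simp: inj_on_def pos_eq_iff)
  then show ?thesis by (simp add: F_def card_image card_cartesian_product)
qed

lemma H_window_cases:
  assumes "k \<in> H" "k \<le> j" "j < k + m"
  shows "j = k \<or> j \<in> F"
proof -
  obtain l where l: "l < q" "k = pos l 0" using assms by (elim H_E)
  then have "j = pos l (j - k)" using assms by (simp add: pos_def)
  then show ?thesis using F_I[of l "j - k"] l(1) assms by (cases "j = k") auto
qed

lemma F_window: "k \<in> F \<Longrightarrow> \<exists>h\<in>H. h \<le> k \<and> k < h + m"
  by (elim F_E) (auto intro!: bexI[OF _ H_I] simp: pos_def)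

lemma H_window_unique:
  assumes "k \<in> H" "k \<le> j" "j < k + m" "k' \<in> H" "k' \<le> j" "j < k' + m"
  shows "k = k'"
proof -
  obtain l where l: "k = pos l 0" using assms by (elim H_E)
  obtain l' where l': "k' = pos l' 0" using assms by (elim H_E)
  have "j = pos l (j - k)" "j = pos l' (j - k')" using assms l l' by (simp_all add: pos_def)
  then have "pos l (j - k) = pos l' (j - k')" by simp
  then show ?thesis using l l' assms by (subst (asm) pos_eq_iff) auto
qed

lemma rep_of_small:
  assumes "j \<le> t0 + m"
  shows "rep_of j \<in> {t0..<t0 + m}" "rep_of j mod m = j mod m"
proof -
  show "rep_of j \<in> {t0..<t0 + m}" using assms m by (simp add: rep_of_def)
  have "rep_of j mod m = (t0 + (j + (m - 1) * t0)) mod m"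
    using assms by (simp add: rep_of_def mod_simps)
  also have "t0 + (j + (m - 1) * t0) = j + m * t0"
    using m by (cases m) (simp_all add: algebra_simps)
  finally show "rep_of j mod m = j mod m" by simp
qed

lemma rep_of_large: "t0 + m < j \<Longrightarrow> rep_of j = j"
  by (simp add: rep_of_def)

lemma rep_of_eq_large:
  assumes "rep_of j = k" "t0 + m < k"
  shows "j = k"
  using assms rep_of_small[of j] rep_of_large[of j] by (cases "j \<le> t0 + m") auto

lemma rep_of_pos:
  assumes "c < m"
  shows "rep_of (pos l c) = pos l c"
proof (cases "l = 0")
  case True
  have k: "pos 0 c \<in> {t0..<t0 + m}" using assms by (simp add: pos_0)
  then have le: "pos 0 c \<le> t0 + m" by simp
  show ?thesis
    unfolding True by (rule mod_inj_on_window[OF rep_of_small(1)[OF le] k rep_of_small(2)[OF le]])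
next
  case False
  then show ?thesis using pos_ge by (simp add: rep_of_large)
qed

lemma rep_of_F: "k \<in> F \<Longrightarrow> rep_of k = k"
  by (elim F_E) (simp add: rep_of_pos)

lemma rep_of_H: "k \<in> H \<Longrightarrow> rep_of k = k"
  using m by (elim H_E) (simp add: rep_of_pos)

lemma rep_of_R: "k \<in> R \<Longrightarrow> rep_of k = k"
  using R_ge[of k] E_less by (simp add: rep_of_large)

lemma lookup_u: "Poly_Mapping.lookup u p =
    (\<Sum>i\<in>{2..t0}. of_bool (p \<in> {i..<i + m})) + (t - t0) * of_bool (p \<in> {1..<1 + m})"
  unfolding u_def lookup_add lookup_sum by (simp add: lookup_ind)

lemma lookup_u_large: "t0 + m \<le> p \<Longrightarrow> Poly_Mapping.lookup u p = 0"
  using t0 by (auto simp: lookup_u)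

lemma prod_\<xi>:
  assumes "finite A"
  shows "(\<Prod>k\<in>A. \<xi> k (c k) :: 'k::field mpoly) =
    (if \<forall>k\<in>A. supports k (c k) then monom_of (\<Sum>k\<in>A. weight k (c k)) else 0)"
proof (cases "\<forall>k\<in>A. supports k (c k)")
  case True
  then have "(\<Prod>k\<in>A. \<xi> k (c k) :: 'k mpoly) = (\<Prod>k\<in>A. monom_of (weight k (c k)))"
    by (intro prod.cong) (auto simp: \<xi>_def)
  then show ?thesis using True by (simp add: prod_monom_of)
next
  case False
  then obtain k where "k \<in> A" "\<xi> k (c k) = (0 :: 'k mpoly)" by (auto simp: \<xi>_def)
  then show ?thesis using False assms by (auto intro!: prod_zero)
qed

lemma \<xi>_closed: "(\<xi> k j :: 'k::field mpoly) \<in> poly_carrier n" if "k \<in> {1..n}"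
proof (cases "supports k j \<and> k \<in> H \<union> F")
  case True
  then have "j \<in> {1..n}"
    using H_bounds[of k] n t0 by (auto simp: supports_def split: if_splits)
  then show ?thesis using True by (auto simp: \<xi>_def weight_def mon_in_poly_carrier)
next
  case False
  then show ?thesis using that by (auto simp: \<xi>_def weight_def mon_in_poly_carrier)
qed

lemma keys_u: "Poly_Mapping.keys u \<subseteq> {1..n}"
proof
  fix p assume "p \<in> Poly_Mapping.keys u"
  then have nz: "Poly_Mapping.lookup u p \<noteq> 0" by (simp add: in_keys_iff)
  then have "p < t0 + m" using lookup_u_large[of p] by (cases "p < t0 + m") auto
  moreover have "1 \<le> p"
  proof (rule ccontr)
    assume "\<not> 1 \<le> p"
    then have "Poly_Mapping.lookup u p = 0" unfolding lookup_u by simp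
    with nz show False by simp
  qed
  ultimately show "p \<in> {1..n}" using E_le_n by simp
qed

lemma supports_R: "k \<in> R \<Longrightarrow> supports k j \<longleftrightarrow> j = k"
  using H_R_disjoint F_R_disjoint by (auto simp: supports_def)

lemma supports_F: "k \<in> F \<Longrightarrow> supports k j \<longleftrightarrow> j \<in> {1..n} \<and> rep_of j = k"
  using H_F_disjoint by (auto simp: supports_def)

lemma supports_H: "k \<in> H \<Longrightarrow> supports k j \<longleftrightarrow> k \<le> j \<and> j < k + m"
  by (auto simp: supports_def)

lemma supports_other: "k \<in> P \<Longrightarrow> k \<notin> H \<Longrightarrow> supports k j \<longleftrightarrow> j = k"
  by (auto simp: supports_def)

lemma supports_self: "k \<in> {1..n} \<Longrightarrow> supports k k"
  using rep_of_F m by (auto simp: supports_def)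

text \<open>The remainder sits at the indices up to \<open>t0 + m\<close> congruent to
  \<open>t0\<close>, at later heads and separators of blocks, and at n if \<open>K = 2\<close>: the
  places where one more variable completes a transversal or a window.\<close>

lemma y_decomposition_Q:
  "(y j :: 'k::field mpoly) =
    (\<Sum>k\<in>F \<union> R. (if k \<in> R then monom_of (Poly_Mapping.single k 1) else 1) * \<xi> k j) +
    (if j \<in> {1..n} \<and> j \<notin> R \<and> rep_of j \<notin> F then monom_of (Poly_Mapping.single j 1) else 0)"
  (is "_ = sum ?f _ + ?\<rho>")
proof -
  have fin: "finite (F \<union> R)" using finite_F finite_R by simp
  consider "j \<in> R" | "j \<notin> R" "j \<in> {1..n}" | "j \<notin> R" "j \<notin> {1..n}" by blast
  then show ?thesis
  proof cases
    case 1
    have "?f k = 0" if "k \<in> F \<union> R" "k \<noteq> j" for k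
      using that 1 rep_of_R[of j] F_R_disjoint[of j] by (auto simp: \<xi>_def supports_F supports_R)
    then have "sum ?f (F \<union> R) = ?f j"
      using sum_eq_single[OF fin, of j ?f] 1 by simp
    moreover have "weight j j = Poly_Mapping.single j (K - 1)"
      using 1 H_R_disjoint F_R_disjoint by (auto simp: weight_def)
    moreover have "1 + (K - 1) = K" using tail by auto
    ultimately have "sum ?f (F \<union> R) = monom_of (Poly_Mapping.single j K)"
      using 1 supports_R[of j j] by (simp add: \<xi>_def mult_single flip: single_add)
    then show ?thesis using 1 R_subset by (auto simp: y_def)
  next
    case 2
    have "?f k = 0" if "k \<in> F \<union> R" "k \<noteq> rep_of j" for k
      using that 2 by (auto simp: \<xi>_def supports_F supports_R)
    then have "sum ?f (F \<union> R) = (if rep_of j \<in> F \<union> R then ?f (rep_of j) else 0)"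
      using sum_eq_single[OF fin, of "rep_of j" ?f] by simp
    moreover have "rep_of j \<notin> R"
      using 2 R_ge[of "rep_of j"] E_less rep_of_eq_large[of j "rep_of j"] by fastforce
    moreover have "?f (rep_of j) = monom_of (Poly_Mapping.single j 1)" if "rep_of j \<in> F"
      using that 2 \<open>rep_of j \<notin> R\<close> by (simp add: \<xi>_def supports_F weight_def)
    ultimately show ?thesis using 2 by (auto simp: y_def)
  next
    case 3
    then have "?f k = 0" if "k \<in> F \<union> R" for k
      using that by (auto simp: \<xi>_def supports_F supports_R)
    then have "sum ?f (F \<union> R) = 0" by (intro sum.neutral ballI)
    moreover have "y j = (0 :: 'k mpoly)" using 3 unfolding y_def by (intro if_not_P)
    ultimately show ?thesis using 3(2) by auto
  qed
qed

text \<open>Every index of a block except its separator lies in the window of exactly one head,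
  whose form accounts for it; the other indices of \<open>P\<close> have forms of their own. Only
  \<open>R\<close> is left over.\<close>

lemma y_decomposition_P:
  "(y j :: 'k::field mpoly) =
    (\<Sum>k\<in>P. (if k \<in> H then 1 else y k) * \<xi> k j) + (if j \<in> R then y j else 0)"
  (is "_ = sum ?f _ + _")
proof -
  have fin: "finite P" by simp
  have R0: "\<xi> k j = (0 :: 'k mpoly)" if "k \<in> P" "j \<in> R \<or> j \<notin> {1..n}" for k
  proof (cases "k \<in> H")
    case True
    then show ?thesis using that H_bounds[of k] R_ge[of j] n t0 by (auto simp: \<xi>_def supports_H)
  next
    case False
    then show ?thesis using that by (auto simp: \<xi>_def supports_other)
  qed
  consider "j \<in> R \<or> j \<notin> {1..n}" | h where "j \<notin> R" "j \<in> {1..n}" "h \<in> H" "h \<le> j" "j < h + m"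
    | "j \<notin> R" "j \<in> {1..n}" "\<forall>h\<in>H. \<not> (h \<le> j \<and> j < h + m)" by blast
  then show ?thesis
  proof cases
    case 1
    then have "sum ?f P = 0" using R0 by (intro sum.neutral) auto
    then show ?thesis using 1 by (auto simp: y_def)
  next
    case 2
    have "?f k = 0" if k: "k \<in> P" "k \<noteq> h" for k
    proof (cases "k \<in> H")
      case True
      then show ?thesis using H_window_unique[of k j h] 2 k by (auto simp: \<xi>_def supports_H)
    next
      case False
      then have "j \<noteq> k" using H_window_cases[of h j] 2 k by auto
      then show ?thesis using False k by (simp add: \<xi>_def supports_other)
    qed
    then have "sum ?f P = ?f h" using sum_eq_single[OF fin, of h ?f] 2 H_subset by auto
    also have "\<dots> = monom_of (Poly_Mapping.single j 1)"
      using 2 by (simp add: \<xi>_def supports_H weight_def)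
    finally show ?thesis using 2 by (simp add: y_def)
  next
    case 3
    have "j \<notin> F" using 3 F_window by blast
    moreover have jH: "j \<notin> H" using 3 m by auto
    ultimately have jP: "j \<in> P" using 3 by auto
    have "?f k = 0" if "k \<in> P" "k \<noteq> j" for k
      using that 3 by (cases "k \<in> H") (auto simp: \<xi>_def supports_H supports_other)
    then have "sum ?f P = ?f j" using sum_eq_single[OF fin, of j ?f] jP by simp
    also have "\<dots> = y j"
      using jP jH \<open>j \<notin> F\<close> 3 by (simp add: \<xi>_def supports_other weight_def)
    finally show ?thesis using 3 by simp
  qed
qed

text \<open>The monomial at which coefficients in top degree are compared.\<close>

definition top_exp :: "nat \<Rightarrow>\<^sub>0 nat" where
  "top_exp = (\<Sum>k\<in>{1..n}. weight k k) + u"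

lemma lookup_top:
  assumes "p \<in> {1..n}"
  shows "Poly_Mapping.lookup top_exp p =
    of_bool (p \<in> H \<union> F) + (K - 1) * of_bool (p \<in> R) + Poly_Mapping.lookup u p"
proof -
  have "(\<Sum>k\<in>{1..n}. Poly_Mapping.lookup (weight k k) p) = Poly_Mapping.lookup (weight p p) p"
    using assms by (subst sum_eq_single[where a = p]) (auto simp: weight_def lookup_single_not_eq)
  moreover have "Poly_Mapping.lookup (weight p p) p = of_bool (p \<in> H \<union> F) + (K - 1) * of_bool (p \<in> R)"
    using H_R_disjoint[of p] F_R_disjoint[of p] by (auto simp: weight_def)
  ultimately show ?thesis by (simp add: top_exp_def lookup_add lookup_sum)
qed

end

section \<open>Which of the occurring monomials t windows divide, and the depth bound of a
  configuration\<close>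

context koszul_config
begin

text \<open>A window of length m meets a residue class at most once, and \<open>u\<close> is a
  product of t - 1 windows.\<close>

lemma sum_u_class_le:
  "(\<Sum>p\<in>{p \<in> {1..<t0 + m}. p mod m = a mod m}. Poly_Mapping.lookup u p) \<le> t - 1" (is "sum _ ?A \<le> _")
proof -
  have one: "(\<Sum>p\<in>?A. of_bool (p \<in> {i..<i + m}) :: nat) \<le> 1" for i
  proof -
    have "(\<Sum>p\<in>?A. of_bool (p \<in> {i..<i + m}) :: nat) = card (?A \<inter> {i..<i + m})"
      by (simp add: sum.If_cases of_bool_def Int_def)
    also have "\<dots> \<le> 1"
      using mod_inj_on_window[where i = i and m = m]
      by (simp add: card_le_Suc0_iff_eq)
    finally show ?thesis .
  qed
  have "(\<Sum>p\<in>?A. Poly_Mapping.lookup u p) =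
      (\<Sum>i\<in>{2..t0}. \<Sum>p\<in>?A. of_bool (p \<in> {i..<i + m})) +
      (t - t0) * (\<Sum>p\<in>?A. of_bool (p \<in> {1..<1 + m}))"
    unfolding lookup_u sum.distrib sum_distrib_left by (subst sum.swap) simp
  also have "\<dots> \<le> (\<Sum>i\<in>{2..t0}. 1) + (t - t0) * 1"
    by (intro add_mono sum_mono mult_left_mono one) auto
  also have "\<dots> = t - 1" using t0 by simp
  finally show ?thesis .
qed

lemma lookup_window_ge:
  assumes "j \<in> {i..<i + m}"
  shows "1 \<le> Poly_Mapping.lookup (window n m i) (cyc_index n j)"
proof -
  have "Poly_Mapping.lookup (Poly_Mapping.single (cyc_index n j) 1) (cyc_index n j) \<le>
      (\<Sum>j'\<in>{i..<i + m}. Poly_Mapping.lookup (Poly_Mapping.single (cyc_index n j') (1 :: nat)) (cyc_index n j))"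
    using assms by (intro member_le_sum) auto
  then show ?thesis by (simp add: window_def lookup_sum)
qed

text \<open>Every window either contains an index outside the support of \<open>b\<close> or meets the residue class of
  \<open>c t0\<close>, whose total exponent in \<open>b\<close> is at most \<open>t - 1\<close>.\<close>

lemma not_windows_divide:
  assumes supp: "\<And>k. k \<in> P \<Longrightarrow> supports k (c k)"
    and top: "top_exp = (\<Sum>k\<in>P. weight k (c k)) + b"
  shows "\<not> windows_divide n m t b"
proof
  let ?b = "Poly_Mapping.lookup b"
  define A where "A = {p \<in> {1..<t0 + m}. p mod m = c t0 mod m}"
  have b_le: "?b p \<le> Poly_Mapping.lookup top_exp p" for p
    by (simp add: top lookup_add)
  \<comment> \<open>The form of the head \<open>k\<close> takes one copy of the variable with index
    \<open>c k\<close> out of the top monomial.\<close>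
  have b_less: "?b (c k) < Poly_Mapping.lookup top_exp (c k)" if "k \<in> H" for k
  proof -
    have "k \<in> P" using that H_subset by auto
    then have "Poly_Mapping.lookup (weight k (c k)) (c k) \<le>
        (\<Sum>k'\<in>P. Poly_Mapping.lookup (weight k' (c k')) (c k))"
      by (intro member_le_sum) auto
    then show ?thesis using that by (simp add: top lookup_add lookup_sum weight_def)
  qed
  have ck: "k \<le> c k \<and> c k < k + m \<and> c k \<in> H \<union> F" if "k \<in> H" for k
  proof -
    have "k \<in> P" using that H_subset by blast
    then have b: "k \<le> c k" "c k < k + m" using supp[of k] that by (simp_all add: supports_H)
    then show ?thesis using H_window_cases[OF that b] that by auto
  qed
  have zero: "?b p = 0" if "t0 + m \<le> p" "p \<in> {1..n}" "p \<notin> H \<union> F" "p \<in> R \<Longrightarrow> K = 1" for p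
    using b_le[of p] that lookup_top[of p] lookup_u_large[of p] by (cases "p \<in> R") auto
  have zero_c: "?b (c k) = 0" if "k \<in> H" "t0 + m \<le> c k" for k
  proof -
    have "c k \<in> {1..n}" using ck[OF that(1)] H_bounds[OF that(1)] n t0 by auto
    moreover have "c k \<notin> R" using ck[OF that(1)] H_R_disjoint F_R_disjoint by auto
    ultimately show ?thesis
      using b_less[OF that(1)] lookup_top[of "c k"] lookup_u_large[OF that(2)] ck[OF that(1)] by auto
  qed
  have sep: "?b (pos l m) = 0" if "l < q" for l
  proof (rule zero)
    show "t0 + m \<le> pos l m" by (simp add: pos_def)
    show "pos l m \<in> {1..n}" using pos_less[OF that, of m] n t0 by (auto simp: pos_def)
    show "pos l m \<notin> H \<union> F" using pos_mem_H[of m l] pos_mem_F[of m l] m by auto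
    show "pos l m \<in> R \<Longrightarrow> K = 1" using R_ge[of "pos l m"] pos_less[OF that, of m] by simp
  qed
  assume "windows_divide n m t b"
  then obtain ws where ws: "length ws = t" "set ws \<subseteq> {1..n}"
    "\<And>p. (\<Sum>i\<leftarrow>ws. Poly_Mapping.lookup (window n m i) p) \<le> ?b p"
    by (auto simp: windows_divide_def)
  have meets: "1 \<le> (\<Sum>p\<in>A. Poly_Mapping.lookup (window n m i) p)" if i: "i \<in> set ws" for i
  proof -
    have i1: "1 \<le> i" "i \<le> n" using ws(2) i by auto
    have pos_b: "?b (cyc_index n j) \<noteq> 0" if "j \<in> {i..<i + m}" for j
    proof -
      have "Poly_Mapping.lookup (window n m i) (cyc_index n j) \<le>
          (\<Sum>i\<leftarrow>ws. Poly_Mapping.lookup (window n m i) (cyc_index n j))"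
        using i by (intro member_le_sum_list) auto
      then show ?thesis using lookup_window_ge[OF that] ws(3)[of "cyc_index n j"] by linarith
    qed
    \<comment> \<open>The index n is the last separator or lies in the tail, where
      \<open>top_exp\<close> avoids it in both configurations. Hence no window can wrap
      around.\<close>
    have n0: "?b n = 0"
    proof (cases "n < t0 + q * (m + 1)")
      case True
      then have "n = pos (q - 1) m" using n q by (cases q) (auto simp: pos_def)
      then show ?thesis using sep[of "q - 1"] q by simp
    next
      case False
      then show ?thesis using E_le_n tail F_bounds[of n] H_bounds[of n] t0
        by (intro zero) auto
    qed
    have lin: "i + m \<le> n"
    proof (rule ccontr)
      assume "\<not> i + m \<le> n"
      then have "n \<in> {i..<i + m}" using i1 by auto
      from pos_b[OF this] show False using n0 i1 by (simp add: cyc_index_id)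
    qed
    then have pos_b': "?b j \<noteq> 0" if "j \<in> {i..<i + m}" for j
      using pos_b[OF that] that i1 by (auto simp: cyc_index_id)
    \<comment> \<open>A window starting after \<open>t0\<close> would meet a separator, the vertex
      removed from a later block, or an index of the tail with exponent zero.\<close>
    have "i + m \<le> t0 + m"
    proof (rule ccontr)
      assume "\<not> i + m \<le> t0 + m"
      then have i_t0: "t0 < i" by simp
      show False
      proof (cases "i \<le> t0 + m")
        case True
        then have "pos 0 m \<in> {i..<i + m}" using i_t0 by (simp add: pos_def)
        from pos_b'[OF this] show False using sep[of 0] q by simp
      next
        case i_E: False
        show False
        proof (cases "i < t0 + q * (m + 1)")
          case True
          then obtain l s where ls: "l < q" "s \<le> m" "i = pos l s"
            using i_t0 pos_cases[of i] by auto
          show False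
          proof (cases "s = 0")
            case True
            then have iH: "i \<in> H" using ls by (simp add: H_I)
            then have "c i \<in> {i..<i + m}" using ck by auto
            from pos_b'[OF this] show False using ck[OF iH] i_E zero_c[OF iH] by simp
          next
            case False
            then have "pos l m \<in> {i..<i + m}" using ls by (auto simp: pos_def)
            from pos_b'[OF this] show False using sep[OF ls(1)] by simp
          qed
        next
          case False
          \<comment> \<open>For \<open>K = 1\<close> the exponents in the tail are zero. For
            \<open>K = 2\<close> the tail consists of m indices ending in n, so \<open>lin\<close>
            forbids a window starting there.\<close>
          then have "?b i = 0"
            using tail lin F_bounds[of i] H_bounds[of i] i1 i_E by (intro zero) auto
          then show False using pos_b'[of i] m by auto
        qed
      qed
    qed
    moreover obtain x where x: "x \<in> {i..<i + m}" "x mod m = c t0 mod m"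
      using window_meets_class[of m i "c t0"] m by auto
    ultimately have xA: "x \<in> A" using i1 by (auto simp: A_def)
    have "1 \<le> Poly_Mapping.lookup (window n m i) x"
      using lookup_window_ge[OF x(1)] x(1) i1 lin by (simp add: cyc_index_id)
    also have "\<dots> \<le> (\<Sum>p\<in>A. Poly_Mapping.lookup (window n m i) p)"
      using xA by (intro member_le_sum) (auto simp: A_def)
    finally show ?thesis .
  qed
  have "t = (\<Sum>i\<leftarrow>ws. 1)" using ws(1) by (simp add: sum_list_triv)
  also have "\<dots> \<le> (\<Sum>i\<leftarrow>ws. \<Sum>p\<in>A. Poly_Mapping.lookup (window n m i) p)"
    using meets by (rule sum_list_mono)
  also have "\<dots> = (\<Sum>p\<in>A. \<Sum>i\<leftarrow>ws. Poly_Mapping.lookup (window n m i) p)"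
    by (induction ws) (simp_all add: sum.distrib)
  also have "\<dots> \<le> (\<Sum>p\<in>A. ?b p)" by (rule sum_mono) (rule ws(3))
  \<comment> \<open>Strict because the form of the head \<open>t0\<close> removed a variable of this
    very class.\<close>
  also have "\<dots> < (\<Sum>p\<in>A. Poly_Mapping.lookup top_exp p)"
  proof (rule sum_strict_mono_ex1)
    have "c t0 \<in> A" using ck[OF t0_in_H] t0 by (auto simp: A_def)
    then show "\<exists>p\<in>A. ?b p < Poly_Mapping.lookup top_exp p" using b_less[OF t0_in_H] by blast
  qed (use b_le in \<open>auto simp: A_def\<close>)
  \<comment> \<open>The windows in \<open>u\<close> contribute at most t - 1 to the class, the first
    block at most one.\<close>
  also have "\<dots> \<le> t"
  proof -
    have "Poly_Mapping.lookup top_exp p \<le> of_bool (p \<in> {t0..<t0 + m}) + Poly_Mapping.lookup u p"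
      if "p \<in> A" for p
    proof -
      have p: "p \<in> {1..n}" "p \<notin> R" "p < t0 + m"
        using that E_le_n E_less R_ge[of p] by (auto simp: A_def)
      moreover have "t0 \<le> p" if "p \<in> H \<union> F" using that H_bounds[of p] F_bounds[of p] by auto
      ultimately show ?thesis by (simp add: lookup_top of_bool_def)
    qed
    then have "(\<Sum>p\<in>A. Poly_Mapping.lookup top_exp p) \<le>
        (\<Sum>p\<in>A. of_bool (p \<in> {t0..<t0 + m})) + (\<Sum>p\<in>A. Poly_Mapping.lookup u p)"
      unfolding sum.distrib[symmetric] by (rule sum_mono)
    also have "(\<Sum>p\<in>A. of_bool (p \<in> {t0..<t0 + m}) :: nat) = card (A \<inter> {t0..<t0 + m})"
    proof -
      have "finite A" by (simp add: A_def)
      then show ?thesis by (simp add: sum.If_cases of_bool_def Int_def)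
    qed
    also have "\<dots> \<le> 1"
      using mod_inj_on_window[where i = t0 and m = m]
      by (simp add: card_le_Suc0_iff_eq A_def)
    also have "(\<Sum>p\<in>A. Poly_Mapping.lookup u p) \<le> t - 1"
      unfolding A_def by (rule sum_u_class_le)
    finally show ?thesis using t0 by simp
  qed
  finally show False by simp
qed

lemma u_eq_sum_list: "u = (\<Sum>i\<leftarrow>[2..<Suc t0] @ replicate (t - t0) 1. ind {i..<i + m})"
proof -
  have "(\<Sum>i\<leftarrow>[2..<Suc t0]. ind {i..<i + m}) = (\<Sum>i\<in>{2..t0}. ind {i..<i + m})"
    by (simp only: interv_sum_list_conv_sum_set_nat set_upt atLeastLessThanSuc_atLeastAtMost)
  then show ?thesis by (simp add: u_def sum_list_replicate del: upt_Suc)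
qed

lemma lookup_sum_list:
  "Poly_Mapping.lookup (\<Sum>i\<leftarrow>ws. f i) p = (\<Sum>i\<leftarrow>ws. Poly_Mapping.lookup (f i :: nat \<Rightarrow>\<^sub>0 nat) p)"
  by (induction ws) (simp_all add: lookup_add)

lemma windows_divideI:
  assumes "\<And>i. i \<in> set ws \<Longrightarrow> 1 \<le> i \<and> i + m \<le> n + 1" "length ws = t"
    and "\<And>p. Poly_Mapping.lookup (\<Sum>i\<leftarrow>ws. ind {i..<i + m}) p \<le> Poly_Mapping.lookup e p"
  shows "windows_divide n m t e"
  unfolding windows_divide_def
proof (intro exI[of _ ws] conjI allI)
  show "set ws \<subseteq> {1..n}" using assms(1) m by fastforce
  have "(\<Sum>i\<leftarrow>ws. Poly_Mapping.lookup (window n m i) p) = (\<Sum>i\<leftarrow>ws. Poly_Mapping.lookup (ind {i..<i + m}) p)" for p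
    using assms(1) by (intro arg_cong[of _ _ sum_list] map_cong) (simp_all add: window_eq_ind)
  then show "(\<Sum>i\<leftarrow>ws. Poly_Mapping.lookup (window n m i) p) \<le> Poly_Mapping.lookup e p" for p
    using assms(3)[of p] by (simp add: lookup_sum_list)
qed (rule assms(2))

text \<open>The forms of \<open>F\<close> in the first block cover all residue classes but that of
  \<open>t0\<close>, to which \<open>j\<close> belongs. The chosen indices and \<open>j\<close> form
  a transversal, which together with the windows at 2, ..., \<open>t0\<close> yields
  \<open>t0\<close> windows.\<close>

lemma windows_divide_transversal:
  assumes supp: "\<And>k. k \<in> F \<union> R \<Longrightarrow> supports k (c k)"
    and j: "j \<in> {1..n}" "rep_of j \<notin> F" "j \<le> t0 + m"
  shows "windows_divide n m t (Poly_Mapping.single j 1 + (\<Sum>k\<in>F \<union> R. weight k (c k)) + u)"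
proof -
  define I where "I = {t0..<t0 + m}"
  define I' where "I' = {t0 + 1..<t0 + m}"
  define g where "g k = (if k = t0 then j else c k)" for k
  have I: "I = insert t0 I'" "t0 \<notin> I'" "finite I'" using m by (auto simp: I_def I'_def)
  have I'F: "I' \<subseteq> F"
  proof
    fix k assume "k \<in> I'"
    then have "k = pos 0 (k - t0)" "1 \<le> k - t0" "k - t0 < m" by (auto simp: I'_def pos_def)
    then show "k \<in> F" using F_I[of 0 "k - t0"] q by simp
  qed
  have rep_j: "rep_of j = t0"
    using rep_of_small(1)[OF j(3)] j(2) I'F I unfolding I_def by auto
  have g: "g k \<in> {1..t0 + m} \<and> g k mod m = k mod m" if k: "k \<in> I" for k
  proof (cases "k = t0")
    case True
    then show ?thesis using j rep_of_small(2)[OF j(3)] rep_j by (simp add: g_def)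
  next
    case False
    then have kF: "k \<in> F" "k < t0 + m" using k I I'F by (auto simp: I_def)
    then have s: "c k \<in> {1..n}" "rep_of (c k) = k" using supp[of k] by (auto simp: supports_F)
    then have le: "c k \<le> t0 + m"
      using rep_of_large[of "c k"] kF(2) by (cases "c k \<le> t0 + m") auto
    then show ?thesis using s rep_of_small(2)[OF le] False by (simp add: g_def)
  qed
  have bij: "bij_betw (\<lambda>x. x mod m) I {..<m}"
    unfolding I_def using m by (intro bij_betw_mod_window) simp
  have eq: "bij_betw (\<lambda>k. g k mod m) I {..<m} \<longleftrightarrow> bij_betw (\<lambda>x. x mod m) I {..<m}"
    using g by (intro bij_betw_cong) blast
  then have bij': "bij_betw (\<lambda>k. g k mod m) I {..<m}" using bij by blast
  then have "inj_on ((\<lambda>x. x mod m) \<circ> g) I" by (simp add: bij_betw_def comp_def)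
  then have "inj_on (\<lambda>x. x mod m) (g ` I)" by (rule inj_on_imageI)
  then have bijT: "bij_betw (\<lambda>x. x mod m) (g ` I) {..<m}"
    using bij' by (simp add: bij_betw_def image_image)
  have inj_g: "inj_on g I"
    using bij' by (auto simp: bij_betw_def inj_on_def)
  have T: "g ` I \<subseteq> {1..t0 + m}" using g by blast
  have "1 \<le> m" using m by simp
  from transversal_windows[OF this t0(1) T bijT] obtain ws where ws: "length ws = t0"
    "set ws \<subseteq> {1..t0 + 1}"
    "(\<Sum>i\<in>{2..t0}. ind {i..<i + m}) + ind (g ` I) = (\<Sum>i\<leftarrow>ws. ind {i..<i + m})"
    by blast
  have "ind (g ` I) = (\<Sum>k\<in>I. Poly_Mapping.single (g k) 1)"
    using inj_g by (simp add: ind_def sum.reindex)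
  also have "\<dots> = Poly_Mapping.single j 1 + (\<Sum>k\<in>I'. Poly_Mapping.single (g k) 1)"
    using I by (simp add: g_def)
  also have "(\<Sum>k\<in>I'. Poly_Mapping.single (g k) 1) = (\<Sum>k\<in>I'. weight k (c k))"
    using I(2) I'F by (intro sum.cong) (auto simp: g_def weight_def)
  finally have indT: "ind (g ` I) = Poly_Mapping.single j 1 + (\<Sum>k\<in>I'. weight k (c k))" .
  have rest: "(\<Sum>k\<in>F \<union> R. weight k (c k)) = (\<Sum>k\<in>F \<union> R - I'. weight k (c k)) + (\<Sum>k\<in>I'. weight k (c k))"
    using I'F finite_F finite_R by (intro sum.subset_diff) auto
  have sum_ws: "(\<Sum>i\<leftarrow>ws @ replicate (t - t0) 1. ind {i..<i + m}) =
      (\<Sum>i\<in>{2..t0}. ind {i..<i + m}) + ind (g ` I) + (\<Sum>i<t - t0. ind {1..<1 + m})"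
    unfolding ws(3) by (simp add: sum_list_replicate)
  show ?thesis
  proof (rule windows_divideI)
    fix p
    show "Poly_Mapping.lookup (\<Sum>i\<leftarrow>ws @ replicate (t - t0) 1. ind {i..<i + m}) p \<le>
        Poly_Mapping.lookup (Poly_Mapping.single j 1 + (\<Sum>k\<in>F \<union> R. weight k (c k)) + u) p"
      unfolding sum_ws indT rest u_def by (simp only: lookup_add)
  next
    fix i assume "i \<in> set (ws @ replicate (t - t0) 1)"
    then have "i \<in> {1..t0 + 1}" using ws(2) by auto
    then show "1 \<le> i \<and> i + m \<le> n + 1" using E_le_n by simp
  qed (use ws(1) t0 in simp)
qed

text \<open>As \<open>u\<close> already consists of t - 1 windows, one further window made of
  \<open>j\<close> and chosen variables is enough.\<close>

lemma windows_divide_extra: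
  assumes i: "1 \<le> i" "i + m \<le> n + 1"
    and mem: "\<And>p. p \<in> {i..<i + m} \<Longrightarrow> p \<noteq> j \<Longrightarrow>
      \<exists>k\<in>F \<union> R. 1 \<le> Poly_Mapping.lookup (weight k (c k)) p"
  shows "windows_divide n m t (Poly_Mapping.single j 1 + (\<Sum>k\<in>F \<union> R. weight k (c k)) + u)"
proof (rule windows_divideI)
  let ?ws = "i # [2..<Suc t0] @ replicate (t - t0) 1"
  fix p
  have "Poly_Mapping.lookup (ind {i..<i + m}) p \<le>
      Poly_Mapping.lookup (Poly_Mapping.single j 1 + (\<Sum>k\<in>F \<union> R. weight k (c k))) p"
  proof (cases "p \<in> {i..<i + m} \<and> p \<noteq> j")
    case True
    then obtain k where k: "k \<in> F \<union> R" "1 \<le> Poly_Mapping.lookup (weight k (c k)) p"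
      using mem[of p] by blast
    have "Poly_Mapping.lookup (weight k (c k)) p \<le> (\<Sum>k\<in>F \<union> R. Poly_Mapping.lookup (weight k (c k)) p)"
      using k(1) finite_F finite_R by (intro member_le_sum) auto
    then show ?thesis using k(2) True by (simp add: lookup_add lookup_sum lookup_ind)
  next
    case False
    then show ?thesis by (auto simp: lookup_add lookup_ind)
  qed
  then show "Poly_Mapping.lookup (\<Sum>i\<leftarrow>?ws. ind {i..<i + m}) p \<le>
      Poly_Mapping.lookup (Poly_Mapping.single j 1 + (\<Sum>k\<in>F \<union> R. weight k (c k)) + u) p"
    unfolding list.map sum_list.Cons u_eq_sum_list by (simp only: lookup_add add_mono)
next
  fix i' assume "i' \<in> set (i # [2..<Suc t0] @ replicate (t - t0) 1)"
  then show "1 \<le> i' \<and> i' + m \<le> n + 1" using i E_le_n by auto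
qed (use t0 in \<open>simp del: upt_Suc\<close>)

lemma windows_divide_rest:
  assumes supp: "\<And>k. k \<in> F \<union> R \<Longrightarrow> supports k (c k)"
    and j: "j \<in> {1..n}" "j \<notin> R" "rep_of j \<notin> F"
  shows "windows_divide n m t (Poly_Mapping.single j 1 + (\<Sum>k\<in>F \<union> R. weight k (c k)) + u)"
proof (cases "j \<le> t0 + m")
  case True
  then show ?thesis using windows_divide_transversal supp j by blast
next
  case large: False
  then have jF: "j \<notin> F" using j rep_of_large[of j] by simp
  have wF: "1 \<le> Poly_Mapping.lookup (weight k (c k)) k" if "k \<in> F" "t0 + m < k" for k
  proof -
    have "rep_of (c k) = k" using supp[of k] that by (simp add: supports_F)
    then have "c k = k" using that(2) by (rule rep_of_eq_large)
    then show ?thesis using that by (simp add: weight_def)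
  qed
  show ?thesis
  proof (cases "j < t0 + q * (m + 1)")
    case True
    then obtain l s where ls: "l < q" "s \<le> m" "j = pos l s" using large pos_cases[of j] by auto
    then have l0: "l \<noteq> 0" using large by (cases l) (auto simp: pos_def)
    have le: "pos l m \<le> n" using pos_less[OF ls(1), of m] n by simp
    have gt: "t0 + m < pos l 0" using pos_ge[OF l0] .
    have mem: "\<exists>k\<in>F \<union> R. 1 \<le> Poly_Mapping.lookup (weight k (c k)) p"
      if "p \<in> {pos l 1..<pos l m}" for p
    proof -
      have "p = pos l (p - pos l 0)" "1 \<le> p - pos l 0" "p - pos l 0 < m"
        using that by (auto simp: pos_def)
      then have "p \<in> F" using F_I[OF ls(1)] by metis
      then show ?thesis using wF[of p] that gt by (intro bexI[of _ p]) (auto simp: pos_def)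
    qed
    \<comment> \<open>The m - 1 vertices of \<open>F\<close> in a block form a window with either
      neighbour, the head or the separator.\<close>
    have "s = 0 \<or> s = m" using ls jF F_I[of l s] by fastforce
    then show ?thesis
    proof
      assume s: "s = 0"
      show ?thesis
      proof (rule windows_divide_extra[of "pos l 0"])
        show "\<exists>k\<in>F \<union> R. 1 \<le> Poly_Mapping.lookup (weight k (c k)) p"
          if "p \<in> {pos l 0..<pos l 0 + m}" "p \<noteq> j" for p
          using that ls s by (intro mem) (auto simp: pos_def)
      qed (use le gt in \<open>auto simp: pos_def\<close>)
    next
      assume s: "s = m"
      show ?thesis
      proof (rule windows_divide_extra[of "pos l 1"])
        show "\<exists>k\<in>F \<union> R. 1 \<le> Poly_Mapping.lookup (weight k (c k)) p"
          if "p \<in> {pos l 1..<pos l 1 + m}" "p \<noteq> j" for p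
          using that ls s by (intro mem) (auto simp: pos_def)
      qed (use le gt in \<open>auto simp: pos_def\<close>)
    qed
  next
    case False
    \<comment> \<open>Only \<open>K = 2\<close> leaves an index behind the blocks outside
      \<open>R\<close>, namely n; it completes the window of tail variables.\<close>
    then have K: "K = 2" "n + 1 = t0 + q * (m + 1) + m" "R = {t0 + q * (m + 1)..<n}" and jn: "j = n"
      using tail j by auto
    show ?thesis
    proof (rule windows_divide_extra[of "t0 + q * (m + 1)"])
      show "\<exists>k\<in>F \<union> R. 1 \<le> Poly_Mapping.lookup (weight k (c k)) p"
        if "p \<in> {t0 + q * (m + 1)..<t0 + q * (m + 1) + m}" "p \<noteq> j" for p
      proof
        have p: "p \<in> R" using that jn K(2) unfolding K(3) by simp
        then show "p \<in> F \<union> R" by simp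
        show "1 \<le> Poly_Mapping.lookup (weight p (c p)) p"
        proof -
          have "weight p (c p) = Poly_Mapping.single p (K - 1)"
            using p H_R_disjoint F_R_disjoint by (auto simp: weight_def)
          then show ?thesis using K(1) by simp
        qed
      qed
    qed (use t0 K in auto)
  qed
qed

lemma P_un_F_un_R: "P \<union> (F \<union> R) = {1..n}"
  using F_subset R_subset by blast

theorem depth_path_power_le:
  "depth (poly_ring n) (max_ideal n)
     (quot_module (self_module (poly_ring n :: 'k::field mpoly ring))
       (cycle_path_ideal n m [^]\<^bsub>ideals_set (poly_ring n)\<^esub> t))
   \<le> enat (q * (m - 1) + card R)"
proof -
  let ?J = "cycle_path_ideal n m :: 'k mpoly set"
  define I where "I = ?J [^]\<^bsub>ideals_set (poly_ring n)\<^esub> t"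
  let ?\<xi> = "\<xi> :: nat \<Rightarrow> nat \<Rightarrow> 'k mpoly"
  let ?y = "y :: nat \<Rightarrow> 'k mpoly"
  let ?\<rho> = "\<lambda>j. if j \<in> {1..n} \<and> j \<notin> R \<and> rep_of j \<notin> F then monom_of (Poly_Mapping.single j 1) else 0 :: 'k mpoly"
  let ?\<rho>' = "\<lambda>j. if j \<in> R then ?y j else 0"
  \<comment> \<open>Not an ideal: multiplication can move another monomial to
    \<open>top_exp\<close>.\<close>
  let ?N = "{p :: 'k mpoly. top_exp \<notin> Poly_Mapping.keys p}"
  have n1: "1 \<le> n" using E_le_n t0 by simp
  have I_ideal: "ideal I (poly_ring n)"
    unfolding I_def by (rule ideal_cycle_path_power[OF n1])
  then have I_of: "poly.ideal_of n I" by (simp add: ideal_of_iff)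
  have y_in: "?y j \<in> poly_carrier n" for j by (auto simp: y_def mon_in_poly_carrier)
  have \<xi>_in: "?\<xi> k j \<in> poly_carrier n" if "k \<in> {1..n}" for k j using \<xi>_closed[OF that] .
  have u_in: "monom_of u \<in> (poly_carrier n :: 'k mpoly set)" using keys_u by (simp add: mon_in_poly_carrier)
  have cardQ: "card (F \<union> R) = q * (m - 1) + card R"
    using finite_F finite_R F_R_disjoint card_F by (subst card_Un_disjoint) auto
  have "\<exists>z. (\<forall>A. z A \<in> poly_carrier n) \<and> poly.koszul_cocycle ?y I (card (F \<union> R)) z \<and>
      \<not> poly.koszul_boundary n ?y I (card (F \<union> R)) z"
  proof (rule poly.koszul_nonvanishing[where \<xi> = "\<lambda>k j. if k \<in> {1..n} then ?\<xi> k j else 0"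
        and P = P and Q = "F \<union> R" and N = ?N and u = "monom_of u"
        and b = "\<lambda>k. if k \<in> R then monom_of (Poly_Mapping.single k 1) else 1" and \<rho> = ?\<rho>
        and b' = "\<lambda>k. if k \<in> H then 1 else ?y k" and \<rho>' = ?\<rho>'])
    show "?y j = (\<Sum>k\<in>F \<union> R. (if k \<in> R then monom_of (Poly_Mapping.single k 1) else 1) *
        (if k \<in> {1..n} then ?\<xi> k j else 0)) + ?\<rho> j" for j
      unfolding y_decomposition_Q using F_subset R_subset
      by (intro arg_cong2[of _ _ _ _ "(+)"] sum.cong refl) auto
    show "?y j = (\<Sum>k\<in>P. (if k \<in> H then 1 else ?y k) * (if k \<in> {1..n} then ?\<xi> k j else 0)) + ?\<rho>' j" for j
      by (subst y_decomposition_P) (intro arg_cong2[of _ _ _ _ "(+)"] sum.cong refl, auto)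
    show "?\<rho> j * ((\<Prod>k\<in>F \<union> R. if k \<in> {1..n} then ?\<xi> k (c k) else 0) * monom_of u) \<in> I" for c j
    proof (cases "(j \<in> {1..n} \<and> j \<notin> R \<and> rep_of j \<notin> F) \<and> (\<forall>k\<in>F \<union> R. supports k (c k))")
      case True
      let ?e = "Poly_Mapping.single j 1 + (\<Sum>k\<in>F \<union> R. weight k (c k)) + u"
      have eq: "(\<Prod>k\<in>F \<union> R. if k \<in> {1..n} then ?\<xi> k (c k) else 0) = (\<Prod>k\<in>F \<union> R. ?\<xi> k (c k))"
        using F_subset R_subset by (intro prod.cong) auto
      then have prod: "(\<Prod>k\<in>F \<union> R. if k \<in> {1..n} then ?\<xi> k (c k) else 0) = monom_of (\<Sum>k\<in>F \<union> R. weight k (c k))"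
        using True finite_F finite_R by (simp add: prod_\<xi>)
      have div: "windows_divide n m t ?e" using True by (intro windows_divide_rest) auto
      have "Poly_Mapping.keys (weight k (c k)) \<subseteq> {1..n}" if "k \<in> F \<union> R" for k
      proof (cases "k \<in> F")
        case kF: True
        then have "c k \<in> {1..n}" using True supports_F[of k "c k"] by blast
        then show ?thesis using kF by (simp add: weight_def)
      next
        case False
        then have "k \<in> R" "k \<in> {1..n}" using that R_subset by auto
        then show ?thesis using False H_R_disjoint[of k] by (auto simp: weight_def)
      qed
      then have "Poly_Mapping.keys (\<Sum>k\<in>F \<union> R. weight k (c k)) \<subseteq> {1..n}"
        using keys_sum[of "\<lambda>k. weight k (c k)" "F \<union> R"] by blast
      moreover have "Poly_Mapping.keys (Poly_Mapping.single j (1 :: nat)) \<subseteq> {1..n}" using True by simp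
      moreover have "Poly_Mapping.keys ?e \<subseteq> Poly_Mapping.keys (Poly_Mapping.single j (1 :: nat)) \<union>
          Poly_Mapping.keys (\<Sum>k\<in>F \<union> R. weight k (c k)) \<union> Poly_Mapping.keys u"
        by (meson Poly_Mapping.keys_add order.trans sup.mono order_refl)
      ultimately have "Poly_Mapping.keys ?e \<subseteq> {1..n}" using keys_u by blast
      then have "monom_of ?e \<in> I" unfolding I_def by (rule mon_in_cycle_path_power[OF n1 div])
      then show ?thesis unfolding prod using True by (simp add: mult_single add.assoc)
    next
      case False
      have zero: "(\<Prod>k\<in>F \<union> R. if k \<in> {1..n} then ?\<xi> k (c k) else 0) = 0"
        if "\<not> (\<forall>k\<in>F \<union> R. supports k (c k))"
        using that finite_F finite_R by (intro prod_zero) (auto simp: \<xi>_def)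
      consider "\<not> (j \<in> {1..n} \<and> j \<notin> R \<and> rep_of j \<notin> F)" | "\<not> (\<forall>k\<in>F \<union> R. supports k (c k))"
        using False by blast
      then have "?\<rho> j * ((\<Prod>k\<in>F \<union> R. if k \<in> {1..n} then ?\<xi> k (c k) else 0) * monom_of u) = 0"
      proof cases
        case 1
        then show ?thesis by (simp only: if_not_P mult_zero_left not_False_eq_True)
      next
        case 2
        then show ?thesis by (simp only: zero[OF 2] mult_zero_left mult_zero_right)
      qed
      then show ?thesis using poly.ideal_ofD(2)[OF I_of] by (simp only:)
    qed
    show "a + b \<in> ?N" if "a \<in> ?N" "b \<in> ?N" for a b
      using that Poly_Mapping.keys_add[of a b] by auto
    \<comment> \<open>At an index of \<open>R\<close> the exponent of \<open>top_exp\<close> is K -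
      1, while every monomial of the product has at least K.\<close>
    show "?\<rho>' j * h \<in> ?N" for j h
    proof (cases "j \<in> R")
      case True
      have "Poly_Mapping.lookup top_exp j < K"
        using lookup_top[of j] True R_subset H_R_disjoint[of j] F_R_disjoint[of j] tail
          lookup_u_large[of j] R_ge[OF True] E_less by auto
      moreover have "K \<le> Poly_Mapping.lookup e j" if "e \<in> Poly_Mapping.keys (monom_of (Poly_Mapping.single j K) * h)" for e
      proof -
        from that obtain b where "e = Poly_Mapping.single j K + b"
          using keys_mult[of "monom_of (Poly_Mapping.single j K)" h] by auto
        then show ?thesis by (simp add: lookup_add)
      qed
      ultimately show ?thesis using True R_subset by (fastforce simp: y_def)
    qed simp
    show "(\<Prod>k\<in>P. if k \<in> {1..n} then ?\<xi> k (c k) else 0) * i \<in> ?N" if i: "i \<in> I" for c i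
    proof -
      have "(\<Prod>k\<in>P. if k \<in> {1..n} then ?\<xi> k (c k) else 0) = (\<Prod>k\<in>P. ?\<xi> k (c k))"
        by (intro prod.cong) auto
      also have "\<dots> * i \<in> ?N"
      proof (cases "\<forall>k\<in>P. supports k (c k)")
        case True
        have "top_exp \<notin> Poly_Mapping.keys (monom_of (\<Sum>k\<in>P. weight k (c k)) * i)"
        proof
          assume "top_exp \<in> Poly_Mapping.keys (monom_of (\<Sum>k\<in>P. weight k (c k)) * i)"
          then obtain b where b: "top_exp = (\<Sum>k\<in>P. weight k (c k)) + b" "b \<in> Poly_Mapping.keys i"
            using keys_mult[of "monom_of (\<Sum>k\<in>P. weight k (c k))" i] by auto
          have "windows_divide n m t b"
            using windows_divide_keys[OF n1] i b(2) unfolding I_def by blast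
          then show False using not_windows_divide[OF _ b(1)] True by blast
        qed
        then show ?thesis using True by (simp add: prod_\<xi>)
      next
        case False
        then have zero: "(\<Prod>k\<in>P. ?\<xi> k (c k)) = 0" by (subst prod_\<xi>) auto
        show ?thesis unfolding zero by simp
      qed
      finally show ?thesis by simp
    qed
    have "(\<Prod>k\<in>{1..n}. if k \<in> {1..n} then ?\<xi> k k else 0) = (\<Prod>k\<in>{1..n}. ?\<xi> k k)"
      by (intro prod.cong) auto
    also have "\<dots> * monom_of u = monom_of top_exp"
      using supports_self by (simp add: prod_\<xi> top_exp_def mult_single)
    finally show "(\<Prod>k\<in>P \<union> (F \<union> R). if k \<in> {1..n} then ?\<xi> k k else 0) * monom_of u \<notin> ?N"
      unfolding P_un_F_un_R by simp
    show "(\<forall>k\<in>P \<union> (F \<union> R) - {p}. (if p \<in> {1..n} then ?\<xi> p k else 0) = 0) \<or>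
        (\<forall>k\<in>P \<union> (F \<union> R) - {p}. (if k \<in> {1..n} then ?\<xi> k p else 0) = 0)" if p: "p \<in> P" for p
    \<comment> \<open>A head is met by no form but its own, so its column is clear; any other form
      of \<open>P\<close> is a single basis vector, so its row is clear.\<close>
    proof (cases "p \<in> H")
      case True
      have "\<not> supports k p" if "k \<noteq> p" "k \<in> {1..n}" for k
      proof
        assume s: "supports k p"
        show False
        proof (cases "k \<in> H \<or> k \<in> F")
          case True
          then show False
            using s that \<open>p \<in> H\<close> m H_window_unique[of k p p] rep_of_H[of p]
            by (auto simp: supports_H supports_F)
        next
          case False
          then show False using s that by (simp add: supports_def)
        qed
      qed
      then show ?thesis by (auto simp: \<xi>_def)
    next
      case False
      then show ?thesis using p by (auto simp: \<xi>_def supports_other)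
    qed
    show "(if p \<in> {1..n} then ?\<xi> p k else 0) = 0" if "p \<in> F \<union> R" "k \<in> F \<union> R" "k \<noteq> p" for p k
      using that rep_of_F[of k] rep_of_R[of k] by (auto simp: \<xi>_def supports_F supports_R)
  qed (use I_of y_in \<xi>_in u_in finite_F finite_R in auto)
  then obtain z where z: "\<And>A. z A \<in> poly_carrier n" "poly.koszul_cocycle ?y I (card (F \<union> R)) z"
    "\<not> poly.koszul_boundary n ?y I (card (F \<union> R)) z" by blast
  have powers: "\<exists>k. var j ^ k \<in> range ?y" if "j \<in> {1..n}" for j
  proof -
    have "var j ^ k = (monom_of (Poly_Mapping.single j k) :: 'k mpoly)" for k
      by (induction k) (simp_all add: var_def mult_single flip: single_add)
    then have "?y j = var j ^ (if j \<in> R then K else 1)" using that by (simp add: y_def)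
    then show ?thesis by (metis rangeI)
  qed
  have gens: "var ` {1..n} \<subseteq> (poly_carrier n :: 'k mpoly set)" using var_closed by blast
  have bound: "length xs \<le> q * (m - 1) + card R"
    if xs: "set xs \<subseteq> max_ideal n"
      and reg: "\<And>i f. i < length xs \<Longrightarrow> f \<in> poly_carrier n \<Longrightarrow>
        xs ! i * f \<in> genideal (poly_ring n) (I \<union> set (take i xs)) \<Longrightarrow>
        f \<in> genideal (poly_ring n) (I \<union> set (take i xs))"
    for xs :: "'k mpoly list"
  proof -
    have "max_ideal n \<subseteq> (poly_carrier n :: 'k mpoly set)"
      using ideal.Icarr[OF ideal_max_ideal] by blast
    then have "poly.regular_mod n I xs"
      using xs reg by (intro regular_modI[OF I_ideal]) auto
    then show ?thesis
      unfolding cardQ[symmetric]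
      using max_ideal_eventual_powers[of _ n "range ?y"] powers xs
      by (intro poly.regular_mod_length_le[OF I_of y_in z]) blast+
  qed
  interpret cyclic_module "poly_ring n" I "quot_module (self_module (poly_ring n)) I"
    by (intro cyclic_module.intro cring_poly_ring I_ideal)
  have window_max: "monom_of (window n m i) \<in> (max_ideal n :: 'k mpoly set)" for i
  proof -
    define d where "d = (\<Sum>j\<in>{i + 1..<i + m}. Poly_Mapping.single (cyc_index n j) (1 :: nat))"
    have "window n m i = Poly_Mapping.single (cyc_index n i) 1 + d"
      using m unfolding window_def d_def by (subst sum.atLeast_Suc_lessThan) auto
    then have eq: "(monom_of (window n m i) :: 'k mpoly) = monom_of d \<otimes>\<^bsub>poly_ring n\<^esub> var (cyc_index n i)"
      by (simp add: var_def mult_single add.commute)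
    have "Poly_Mapping.keys d \<subseteq> {1..n}"
      using keys_window[OF n1, of "m - 1" "i + 1"] m by (simp add: window_def d_def)
    then have d: "(monom_of d :: 'k mpoly) \<in> poly_carrier n" by (simp only: mon_in_poly_carrier)
    have "var (cyc_index n i) \<in> (max_ideal n :: 'k mpoly set)"
      using poly.genideal_self[OF gens] cyc_index_range[OF n1, of i] unfolding max_ideal_def by blast
    from ideal.I_l_closed[OF ideal_max_ideal this d] show ?thesis unfolding eq .
  qed
  have "?J \<subseteq> max_ideal n"
    unfolding cycle_path_ideal_def
    by (rule poly.genideal_minimal[OF ideal_max_ideal]) (use window_max in \<open>auto simp: prod_var_eq\<close>)
  moreover have "I \<subseteq> ?J"
  proof -
    obtain t' where "t = Suc t'" using t0 by (cases t) auto
    then show ?thesis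
      unfolding I_def using cycle_path_power_Suc[OF n1]
        poly.ideal_prod_inter[OF ideal_cycle_path_power[OF n1] ideal_cycle_path_ideal[OF n1]] by blast
  qed
  ultimately have I_max: "I \<subseteq> max_ideal n" by blast
  have one: "1 \<notin> (max_ideal n :: 'k mpoly set)"
    using max_ideal_proper by fastforce
  show ?thesis
    using depth_le[OF gens, of "q * (m - 1) + card R"] I_max one bound
    unfolding I_def[symmetric] max_ideal_def[symmetric] by simp
qed

end

section \<open>Arithmetic of the bound\<close>

lemma phi_value:
  assumes eq: "int N - int t + 2 = int q * (int m + 1) + int r"
    and r: "r \<le> m" and t: "int t \<le> int N + 1 - int m"
  shows "phi N m t = int q * (int m - 1) + int r - of_bool (0 < r)"
proof -
  define a where "a = int N - int t + 2"
  have a: "real_of_int a / real (m + 1) = real q + real r / real (m + 1)"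
    unfolding a_def eq by (simp add: field_simps)
  have fl: "\<lfloor>real_of_int a / real (m + 1)\<rfloor> = int q"
    unfolding a using r by (intro floor_unique) (simp_all add: field_simps)
  \<comment> \<open>Ceiling and floor differ by one exactly when the remainder is positive.\<close>
  have ce: "\<lceil>real_of_int a / real (m + 1)\<rceil> = int q + of_bool (0 < r)"
    unfolding a using r by (intro ceiling_unique) (simp_all add: field_simps of_bool_def)
  have "phi N m t = a - \<lfloor>real_of_int a / real (m + 1)\<rfloor> - \<lceil>real_of_int a / real (m + 1)\<rceil>"
    using t by (simp add: phi_def a_def)
  also have "\<dots> = int q * (int m - 1) + int r - of_bool (0 < r)"
    unfolding fl ce unfolding a_def eq by (simp add: algebra_simps)
  finally show ?thesis .
qed

theorem theorem2p6:
  fixes n m t :: nat and S :: "'k::field mpoly ring"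
  assumes "n > m" and "m \<ge> 2" and "t \<ge> 1"
    and "S = poly_ring n"
    and "n \<ge> 2 * m + 1"
  shows "ereal_of_enat
           (depth S (max_ideal n)
             (quot_module (self_module S) (cycle_path_ideal n m [^]\<^bsub>ideals_set S\<^esub> t)))
         \<le> ereal (real_of_int
             (if t \<le> n - 2 * m then phi n m t
              else if t \<le> n - m then phi (n - 1) m t + 1
              else int m))"
    (is "ereal_of_enat ?depth \<le> ereal (real_of_int ?bound)")
proof -
  have bound: ?thesis if "?depth \<le> enat d" "int d \<le> ?bound" for d
  proof -
    have "ereal_of_enat ?depth \<le> ereal_of_enat (enat d)" using that(1) by (simp only: ereal_of_enat_le_iff)
    also have "\<dots> = ereal (real d)" by simp
    also have "\<dots> \<le> ereal (real_of_int ?bound)"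
      using that(2) by (metis ereal_less_eq(3) of_int_le_iff of_int_of_nat_eq)
    finally show ?thesis .
  qed
  \<comment> \<open>The configurations with \<open>K = 1\<close>: each leftover index costs one
    degree.\<close>
  have deleted: "?depth \<le> enat (q * (m - 1) + (n + 1 - (t0 + q * (m + 1))))"
    if "1 \<le> t0" "t0 \<le> t" "1 \<le> q" "t0 + q * (m + 1) \<le> n + 1" for t0 q
  proof -
    interpret koszul_config n m t t0 q 1 "{t0 + q * (m + 1)..n}"
      using that assms by unfold_locales auto
    show ?thesis using depth_path_power_le[where 'k = 'k] assms(4) by simp
  qed
  \<comment> \<open>The configurations with \<open>K = 2\<close> and \<open>t0 = t\<close>: m
    leftover indices cost m - 1 degrees.\<close>
  have localized: "?depth \<le> enat (q * (m - 1) + (m - 1))"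
    if "1 \<le> q" "n + 1 = t + q * (m + 1) + m" for q
  proof -
    interpret koszul_config n m t t q 2 "{t + q * (m + 1)..<n}"
      using that assms by unfold_locales auto
    have "n - (t + q * (m + 1)) = m - 1" using that(2) by simp
    then show ?thesis using depth_path_power_le[where 'k = 'k] assms(4) by simp
  qed
  \<comment> \<open>The indices from t to n are divided here, while \<open>phi n m t\<close> divides
    one more. A remainder r < m becomes r + 1 there, and the unit subtracted for a positive
    remainder cancels the shift.\<close>
  define q where "q = (n + 1 - t) div (m + 1)"
  define r where "r = (n + 1 - t) mod (m + 1)"
  have s: "n + 1 - t = q * (m + 1) + r" unfolding q_def r_def by (rule div_mult_mod_eq[symmetric])
  have r: "r \<le> m" unfolding r_def using mod_less_divisor[of "m + 1"] by (simp add: less_Suc_eq_le)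
  have m1: "int (m - 1) = int m - 1" using assms(2) by simp
  show ?thesis
  proof (cases "t \<le> n - m")
    case False
    \<comment> \<open>A single block ending exactly at n, with \<open>t0 = n - m\<close>. The
      resulting m - 1 is one below the claimed m.\<close>
    have "?depth \<le> enat (1 * (m - 1) + (n + 1 - (n - m + 1 * (m + 1))))"
      using False assms by (intro deleted) auto
    moreover have "n + 1 - (n - m + 1 * (m + 1)) = 0" using assms by simp
    ultimately show ?thesis using False assms by (intro bound[of "m - 1"]) auto
  next
    case t: True
    have q: "1 \<le> q" unfolding q_def using t assms by (simp add: div_greater_zero_iff Suc_le_eq)
    have le: "t + q * (m + 1) \<le> n + 1" using s t by linarith
    have R: "n + 1 - (t + q * (m + 1)) = r" using s by linarith
    have s': "int n + 1 - int t = int q * (int m + 1) + int r"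
    proof -
      have "int (n + 1 - t) = int (q * (m + 1) + r)" by (simp only: s)
      then show ?thesis using t by (simp add: of_nat_diff algebra_simps)
    qed
    have depth: "?depth \<le> enat (q * (m - 1) + r)"
      using deleted[OF assms(3) order_refl q le] unfolding R .
    show ?thesis
    proof (cases "t \<le> n - 2 * m")
      case small: True
      have tm: "int t \<le> int n + 1 - int m" using t assms by linarith
      show ?thesis
      proof (cases "r = m")
        case True
        \<comment> \<open>The shift by one completes another block, so \<open>phi\<close> allows
          only m - 1 for the m leftover indices, which \<open>deleted\<close> would miss by
          one.\<close>
        have "int n - int t + 2 = int (q + 1) * (int m + 1) + int 0"
          using s' True by (simp add: algebra_simps)
        from phi_value[OF this le0 tm] have "phi n m t = int (q * (m - 1) + (m - 1))"
          by (simp only: of_nat_add of_nat_mult m1) (simp add: algebra_simps)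
        moreover have "n + 1 = t + q * (m + 1) + m" using R True le by linarith
        ultimately show ?thesis using localized[OF q] small by (intro bound) auto
      next
        case False
        have "int n - int t + 2 = int q * (int m + 1) + int (r + 1)" using s' by simp
        from phi_value[OF this _ tm] have "phi n m t = int (q * (m - 1) + r)"
          using False r m1 by simp
        then show ?thesis using depth small by (intro bound) auto
      qed
    next
      case False
      \<comment> \<open>With n - 1 the two divisions agree, and the added 1 makes up for the unit
        lost when r is positive.\<close>
      have "int (n - 1) - int t + 2 = int q * (int m + 1) + int r" using s' assms by simp
      moreover have "int t \<le> int (n - 1) + 1 - int m" using t assms by linarith
      ultimately have "phi (n - 1) m t = int q * (int m - 1) + int r - of_bool (0 < r)"
        using r by (intro phi_value) auto
      then have "int (q * (m - 1) + r) \<le> phi (n - 1) m t + 1" using m1 by simp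
      then show ?thesis using depth False t by (intro bound) auto
    qed
  qed
qed

end
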